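(* Let $j\in\{1,\tfrac32,2,\dots\}$. The algebra $\overline{AW}(j,\tfrac12,\tfrac12)$ is isomorphic to the one-boundary Temperley--Lieb algebra $1bTL_2(q,2j+1)$. An isomorphism $\overline{AW}(j,\tfrac12,\tfrac12)\to 1bTL_2(q,2j+1)$ is given explicitly by $$\tilde A\mapsto \tilde\chi_{j+\frac12}-[2j]_q\,\sigma_0,\qquad \tilde B\mapsto [2]_q-\sigma_1,$$ where $\tilde A,\tilde B\in\overline{AW}(j,\tfrac12,\tfrac12)$ are defined by $A=(q-q^{-1})^2\tilde A+q+q^{-1}$ and $B=(q-q^{-1})^2\tilde B+q+q^{-1}$.
   Context: Throughout, $q\in\mathbb{C}$ is nonzero and not a root of unity, and all algebras are unital associative algebras over $\mathbb{C}$. Put $[x]_q=\frac{q^x-q^{-x}}{q-q^{-1}}$ and $\tilde\chi_s=[s]_q[s+1]_q$ (for half-integer $s$ a square root $q^{1/2}$ is fixed; $\tilde\chi_s$ does not depend on its choice). The one-boundary Temperley--Lieb algebra $1bTL_2(q,\omega)$ is generated by $\sigma_0,\sigma_1$ with defining relations $\sigma_0^2=\frac{[\omega]_q}{[\omega-1]_q}\sigma_0$, $\sigma_1^2=(q+q^{-1})\sigma_1$, $\sigma_1\sigma_0\sigma_1=\sigma_1$. For $j\in\{0,\tfrac12,1,\dots\}$ put $\chi_j=q^{2j+1}+q^{-2j-1}$. Sets: $\mathcal{J}(j_1,j_2)=\{|j_1-j_2|,|j_1-j_2|+1,\dots,j_1+j_2\}$, $\mathcal{J}(j_1,j_2,j_3)=\bigcup_{j\in\mathcal{J}(j_1,j_2)}\mathcal{J}(j,j_3)$,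 $\mathcal{M}(j_a,j_b,j_c)=\bigcup_{j\in\mathcal{J}(j_a,j_b)}\{\chi_\ell-\chi_j : \ell\in\mathcal{J}(j,j_c)\}$ (all sets without repetition). With $[X,Y]_q=qXY-q^{-1}YX$, the centrally extended Askey--Wilson algebra $AW(3)$ is the algebra generated by $A,B,D$ and central elements $\alpha_1,\alpha_2,\alpha_3,K$ with defining relations $$A+\frac{[B,D]_q}{q^2-q^{-2}}=\frac{\alpha_1\alpha_2+\alpha_3K}{q+q^{-1}},\quad B+\frac{[D,A]_q}{q^2-q^{-2}}=\frac{\alpha_2\alpha_3+\alpha_1K}{q+q^{-1}},\quad D+\frac{[A,B]_q}{q^2-q^{-2}}=\frac{\alpha_1\alpha_3+\alpha_2K}{q+q^{-1}}.$$ The element $D'\in AW(3)$ is defined by $D'+\frac{[B,A]_q}{q^2-q^{-2}}=\frac{\alpha_1\alpha_3+\alpha_2K}{q+q^{-1}}$, and $$\Omega=qA(\alpha_1\alpha_2+\alpha_3K)+q^{-1}B(\alpha_2\alpha_3+\alpha_1K)+qD(\alpha_1\alpha_3+\alpha_2K)-q^2A^2-q^{-2}B^2-q^2D^2-qABD.$$ The algebra $\overline{AW}(j_1,j_2,j_3)$ is the quotient of $AW(3)$ by the relations: $\alpha_i=\chi_{j_i}$ ($i=1,2,3$); $\prod_{j\in\mathcal{J}(j_1,j_2)}(A-\chi_j)=0$; $\prod_{j\in\mathcal{J}(j_2,j_3)}(B-\chi_j)=0$; $\prod_{j\in\mathcal{J}(j_1,j_2,j_3)}(K-\chi_j)=0$;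 $\prod_{j\in\mathcal{J}(j_1,j_3)}(D-\chi_j)=0$; $\prod_{j\in\mathcal{J}(j_1,j_3)}(D'-\chi_j)=0$; $\prod_{m\in\mathcal{M}(j_1,j_2,j_3)}(K-A-m)=0$; $\prod_{m\in\mathcal{M}(j_2,j_3,j_1)}(K-B-m)=0$; $\prod_{m\in\mathcal{M}(j_1,j_3,j_2)}(K-D-m)=0$; $\prod_{m\in\mathcal{M}(j_1,j_3,j_2)}(K-D'-m)=0$; and $\Omega=\chi_{j_1}^2+\chi_{j_2}^2+\chi_{j_3}^2+K^2+\chi_{j_1}\chi_{j_2}\chi_{j_3}K-(q+q^{-1})^2$. *)

theory Defs
  imports
    "HOL-Analysis.Complex_Transcendental"
    "HOL-Library.Poly_Mapping"
    "HOL-Algebra.QuotRing"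
    "HOL-Algebra.Module"
begin

section \<open>Free algebras, quotients and presentations over the complex numbers\<close>

text \<open>Words in the generators under concatenation, written additively because the convolution
  product of \<^theory>\<open>HOL-Library.Poly_Mapping\<close> is set up for additive index monoids.
  The ring of finitely supported functions on words is then the free unital associative algebra.\<close>

datatype 'g mon = Mon (letters: "'g list")

instantiation mon :: (type) monoid_add
begin
definition zero_mon :: "'a mon" where "0 = Mon []"
definition plus_mon :: "'a mon \<Rightarrow> 'a mon \<Rightarrow> 'a mon"
  where "u + v = Mon (letters u @ letters v)"
instance by standard (simp_all add: zero_mon_def plus_mon_def)
end

type_synonym 'g falg = "'g mon \<Rightarrow>\<^sub>0 complex"

definition gen :: "'g \<Rightarrow> 'g falg"
  where "gen g = Poly_Mapping.single (Mon [g]) 1"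

definition const :: "complex \<Rightarrow> 'g falg"
  where "const c = Poly_Mapping.single 0 c"

lemma const_simps:
  "const 0 = 0" "const 1 = 1" "const (a + b) = const a + const b"
  "const (a * b) = const a * const b"
  by (simp_all add: const_def single_add mult_single)

text \<open>Complex algebras are represented by the library's record of rings with a scalar
  multiplication; its locale \<open>algebra\<close> is not used, since that one demands commutativity.\<close>

definition free_alg :: "(complex, 'g falg) module"
  where "free_alg = \<lparr>carrier = UNIV, mult = (*), one = 1, zero = 0, add = (+),
           smult = (\<lambda>c x. const c * x)\<rparr>"

lemma ring_free_alg: "ring free_alg"
proof (rule ringI)
  show "abelian_group (free_alg :: (complex, 'g falg) module)"
  proof (rule abelian_groupI)
    fix x :: "'g falg"
    show "\<exists>y\<in>carrier free_alg. y \<oplus>\<^bsub>free_alg\<^esub> x = \<zero>\<^bsub>free_alg\<^esub>"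
      by (rule bexI[of _ "- x"]) (simp_all add: free_alg_def)
  qed (simp_all add: free_alg_def algebra_simps)
  show "monoid (free_alg :: (complex, 'g falg) module)"
    by (rule monoidI) (simp_all add: free_alg_def algebra_simps)
qed (simp_all add: free_alg_def algebra_simps)

text \<open>Quotient of an algebra by the two-sided ideal generated by a set \<open>S\<close> (the relations
  \<open>s = 0\<close> for \<open>s\<close> in \<open>S\<close>). A ring ideal of a unital algebra is a linear subspace, because
  \<open>c x = (c 1) x\<close>, so scalar multiplication passes to cosets.\<close>

definition alg_quot :: "(complex, 'b) module \<Rightarrow> 'b set \<Rightarrow> (complex, 'b set) module"
  where "alg_quot A S =
    (let I = Idl\<^bsub>A\<^esub> S; Q = A Quot I in
     \<lparr>carrier = carrier Q, mult = mult Q, one = one Q, zero = zero Q, add = add Q,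
      smult = (\<lambda>c X. \<Union>x\<in>X. I +>\<^bsub>A\<^esub> (c \<odot>\<^bsub>A\<^esub> x))\<rparr>)"

definition quot_class :: "(complex, 'b) module \<Rightarrow> 'b set \<Rightarrow> 'b \<Rightarrow> 'b set"
  where "quot_class A S x = (Idl\<^bsub>A\<^esub> S) +>\<^bsub>A\<^esub> x"

definition alg_hom :: "(complex, 'a) module \<Rightarrow> (complex, 'b) module \<Rightarrow> ('a \<Rightarrow> 'b) set"
  where "alg_hom A B = {h \<in> ring_hom A B.
           \<forall>c. \<forall>x\<in>carrier A. h (c \<odot>\<^bsub>A\<^esub> x) = c \<odot>\<^bsub>B\<^esub> h x}"

definition alg_iso :: "(complex, 'a) module \<Rightarrow> (complex, 'b) module \<Rightarrow> ('a \<Rightarrow> 'b) set"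
  where "alg_iso A B = {h \<in> alg_hom A B. bij_betw h (carrier A) (carrier B)}"

text \<open>Product over a finite set of pairwise commuting elements of a noncommutative ring; all
  products below have factors \<open>X - c\<close> with a fixed \<open>X\<close> and scalars \<open>c\<close>.\<close>

definition aprod :: "('i \<Rightarrow> 'g falg) \<Rightarrow> 'i set \<Rightarrow> 'g falg"
  where "aprod f S = Finite_Set.fold (\<lambda>i P. f i * P) 1 S"

lemma aprod_empty: "aprod f {} = 1"
  by (simp add: aprod_def)

lemma aprod_insert:
  assumes "finite S" "i \<notin> S"
    and "\<And>a b. a \<in> insert i S \<Longrightarrow> b \<in> insert i S \<Longrightarrow> f a * f b = f b * f a"
  shows "aprod f (insert i S) = f i * aprod f S"
proof -
  interpret comp_fun_commute_on "insert i S" "\<lambda>i P. f i * P"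
    by unfold_locales
      (auto simp: fun_eq_iff mult.assoc[symmetric] intro: arg_cong2[where f = "(*)"] assms(3))
  show ?thesis
    unfolding aprod_def by (rule fold_insert) (use assms in auto)
qed

section \<open>Quantum numbers and index sets\<close>

text \<open>\<open>q powr x\<close> is the principal power \<open>exp (x ln q)\<close>: it agrees with the usual power for
  integral \<open>x\<close>, and for half-integral \<open>x\<close> it is a power of the fixed square root
  \<open>q powr (1/2)\<close> of \<open>q\<close>.\<close>

definition qnum :: "complex \<Rightarrow> complex \<Rightarrow> complex"
  where "qnum q x = (q powr x - q powr (- x)) / (q - inverse q)"

definition chi_tilde :: "complex \<Rightarrow> real \<Rightarrow> complex"
  where "chi_tilde q s = qnum q (of_real s) * qnum q (of_real (s + 1))"

definition chi :: "complex \<Rightarrow> real \<Rightarrow> complex"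
  where "chi q j = q powr of_real (2 * j + 1) + q powr of_real (- 2 * j - 1)"

definition J2 :: "real \<Rightarrow> real \<Rightarrow> real set"
  where "J2 j1 j2 = {\<bar>j1 - j2\<bar> + real k | k::nat. \<bar>j1 - j2\<bar> + real k \<le> j1 + j2}"

definition J3 :: "real \<Rightarrow> real \<Rightarrow> real \<Rightarrow> real set"
  where "J3 j1 j2 j3 = (\<Union>j\<in>J2 j1 j2. J2 j j3)"

definition M3 :: "complex \<Rightarrow> real \<Rightarrow> real \<Rightarrow> real \<Rightarrow> complex set"
  where "M3 q ja jb jc = (\<Union>j\<in>J2 ja jb. {chi q l - chi q j | l. l \<in> J2 j jc})"

section \<open>The one-boundary Temperley--Lieb algebra\<close>

datatype tl_gen = Sigma0 | Sigma1

abbreviation "sigma0 \<equiv> gen Sigma0"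
abbreviation "sigma1 \<equiv> gen Sigma1"

definition onebTL2_rels :: "complex \<Rightarrow> complex \<Rightarrow> tl_gen falg set"
  where "onebTL2_rels q \<omega> =
    {sigma0^2 - const (qnum q \<omega> / qnum q (\<omega> - 1)) * sigma0,
     sigma1^2 - const (q + inverse q) * sigma1,
     sigma1 * sigma0 * sigma1 - sigma1}"

definition onebTL2 :: "complex \<Rightarrow> complex \<Rightarrow> (complex, tl_gen falg set) module"
  where "onebTL2 q \<omega> = alg_quot free_alg (onebTL2_rels q \<omega>)"

definition onebTL2_class :: "complex \<Rightarrow> complex \<Rightarrow> tl_gen falg \<Rightarrow> tl_gen falg set"
  where "onebTL2_class q \<omega> = quot_class free_alg (onebTL2_rels q \<omega>)"

section \<open>The centrally extended Askey--Wilson algebra and its quotient\<close>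

datatype aw_gen = GA | GB | GD | GAlpha1 | GAlpha2 | GAlpha3 | GK

abbreviation "aA \<equiv> gen GA"
abbreviation "aB \<equiv> gen GB"
abbreviation "aD \<equiv> gen GD"
abbreviation "al1 \<equiv> gen GAlpha1"
abbreviation "al2 \<equiv> gen GAlpha2"
abbreviation "al3 \<equiv> gen GAlpha3"
abbreviation "aK \<equiv> gen GK"

definition qcomm :: "complex \<Rightarrow> 'g falg \<Rightarrow> 'g falg \<Rightarrow> 'g falg"
  where "qcomm q X Y = const q * X * Y - const (inverse q) * Y * X"

definition qcomm_norm :: "complex \<Rightarrow> 'g falg \<Rightarrow> 'g falg \<Rightarrow> 'g falg"
  where "qcomm_norm q X Y = const (1 / (q^2 - inverse q^2)) * qcomm q X Y"

definition over_q2 :: "complex \<Rightarrow> 'g falg \<Rightarrow> 'g falg"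
  where "over_q2 q X = const (1 / (q + inverse q)) * X"

definition AW3_rels :: "complex \<Rightarrow> aw_gen falg set"
  where "AW3_rels q =
    {z * gen g - gen g * z | z g. z \<in> {al1, al2, al3, aK}} \<union>
    {aA + qcomm_norm q aB aD - over_q2 q (al1 * al2 + al3 * aK),
     aB + qcomm_norm q aD aA - over_q2 q (al2 * al3 + al1 * aK),
     aD + qcomm_norm q aA aB - over_q2 q (al1 * al3 + al2 * aK)}"

definition AW3 :: "complex \<Rightarrow> (complex, aw_gen falg set) module"
  where "AW3 q = alg_quot free_alg (AW3_rels q)"

definition AW3_class :: "complex \<Rightarrow> aw_gen falg \<Rightarrow> aw_gen falg set"
  where "AW3_class q = quot_class free_alg (AW3_rels q)"

text \<open>Elements of AW(3) such as \<open>D'\<close> and \<open>\<Omega>\<close> are given by representatives in the free algebra.\<close>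

definition aD' :: "complex \<Rightarrow> aw_gen falg"
  where "aD' q = over_q2 q (al1 * al3 + al2 * aK) - qcomm_norm q aB aA"

definition Omega :: "complex \<Rightarrow> aw_gen falg"
  where "Omega q =
      const q * aA * (al1 * al2 + al3 * aK)
    + const (inverse q) * aB * (al2 * al3 + al1 * aK)
    + const q * aD * (al1 * al3 + al2 * aK)
    - const (q^2) * aA^2 - const (inverse q^2) * aB^2 - const (q^2) * aD^2
    - const q * aA * aB * aD"

definition AW_bar_rels :: "complex \<Rightarrow> real \<Rightarrow> real \<Rightarrow> real \<Rightarrow> aw_gen falg set"
  where "AW_bar_rels q j1 j2 j3 =
    {al1 - const (chi q j1), al2 - const (chi q j2), al3 - const (chi q j3),
     aprod (\<lambda>j. aA - const (chi q j)) (J2 j1 j2),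
     aprod (\<lambda>j. aB - const (chi q j)) (J2 j2 j3),
     aprod (\<lambda>j. aK - const (chi q j)) (J3 j1 j2 j3),
     aprod (\<lambda>j. aD - const (chi q j)) (J2 j1 j3),
     aprod (\<lambda>j. aD' q - const (chi q j)) (J2 j1 j3),
     aprod (\<lambda>m. aK - aA - const m) (M3 q j1 j2 j3),
     aprod (\<lambda>m. aK - aB - const m) (M3 q j2 j3 j1),
     aprod (\<lambda>m. aK - aD - const m) (M3 q j1 j3 j2),
     aprod (\<lambda>m. aK - aD' q - const m) (M3 q j1 j3 j2),
     Omega q - (const ((chi q j1)^2 + (chi q j2)^2 + (chi q j3)^2) + aK^2
       + const (chi q j1 * chi q j2 * chi q j3) * aK - const ((q + inverse q)^2))}"

definition AW_bar :: "complex \<Rightarrow> real \<Rightarrow> real \<Rightarrow> real \<Rightarrow> (complex, aw_gen falg set set) module"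
  where "AW_bar q j1 j2 j3 = alg_quot (AW3 q) (AW3_class q ` AW_bar_rels q j1 j2 j3)"

definition AW_bar_class ::
    "complex \<Rightarrow> real \<Rightarrow> real \<Rightarrow> real \<Rightarrow> aw_gen falg \<Rightarrow> aw_gen falg set set"
  where "AW_bar_class q j1 j2 j3 x =
    quot_class (AW3 q) (AW3_class q ` AW_bar_rels q j1 j2 j3) (AW3_class q x)"

definition tilde :: "complex \<Rightarrow> 'g falg \<Rightarrow> 'g falg"
  where "tilde q X = const (1 / (q - inverse q)^2) * (X - const (q + inverse q))"

lemma tilde_eq:
  assumes "q \<noteq> inverse q"
  shows "X = const ((q - inverse q)^2) * tilde q X + const (q + inverse q)"
proof -
  have "const ((q - inverse q)^2) * tilde q X
      = const ((q - inverse q)^2 * (1 / (q - inverse q)^2)) * (X - const (q + inverse q))"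
    by (simp only: tilde_def const_simps mult.assoc)
  also have "(q - inverse q)^2 * (1 / (q - inverse q)^2) = 1"
    using assms by simp
  finally show ?thesis by (simp add: const_simps(2))
qed

end

theory Submission
  imports Defs
begin

text \<open>The algebra \<open>1bTL\<^sub>2\<close> embeds into a product of two copies of the complex numbers and a
  \<open>2 \<times> 2\<close> matrix algebra: it is spanned by six words, whose images are linearly independent.
  Assigning to \<open>\<sigma>\<^sub>0\<close>, \<open>\<sigma>\<^sub>1\<close> the affine expressions in \<open>A\<close>, \<open>B\<close> that invert the asserted formulas
  maps it to the quotient of the Askey--Wilson algebra. This respects the relations: on the
  eigenspaces of the central element \<open>K\<close> other than \<open>\<chi>\<^sub>j\<close> the relations on \<open>K - A\<close> and
  \<open>K - D\<close> make \<open>A\<close> and \<open>D\<close> scalar and force \<open>\<sigma>\<^sub>1 = 0\<close>, and on the remaining one the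
  quadratic relation of \<open>D\<close> determines \<open>\<sigma>\<^sub>1\<sigma>\<^sub>0\<sigma>\<^sub>1\<close>. It is onto because \<open>K\<close>, hence \<open>D\<close>, is a
  polynomial in \<open>A\<close> and \<open>B\<close>. It is injective because the three representations extend to the
  quotient of the Askey--Wilson algebra.\<close>

section \<open>Free algebras\<close>

text \<open>The three representations have a source: \<open>K\<close>, \<open>A\<close>,
  \<open>B\<close> behave like Casimir elements of the tensor product of spins j, 1/2, 1/2 and of
  its pairs of factors. Total spin j - 1, j, j + 1 occurs there with multiplicity 1, 2, 1; hence the
  eigenvalues \<open>k1\<close>, \<open>al\<close>, \<open>k3\<close> of \<open>K\<close> and the
  dimensions 1, 2, 1. A map out of \<open>AW_bar\<close> would have to be checked on its long list
  of relations, with \<open>K\<close> and \<open>D\<close> replaced by polynomials in sigma0 and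
  sigma1. In each of the three representations \<open>K\<close> is a scalar, and the list reduces to
  identities between numbers or 2 by 2 matrices. Conversely, only the three relations of 1bTL have
  to be derived in \<open>AW_bar\<close>. Both halves meet in one statement about the fibres of two
  surjections from a free algebra, so no inverse map is built. All numbers are Laurent polynomials
  in q and z = q^(2j+1); that q is not a root of unity enters only through inequalities between
  them.\<close>

definition central_hom :: "(complex \<Rightarrow> 'b::ring_1) \<Rightarrow> bool"
  where "central_hom c \<longleftrightarrow> c 1 = 1 \<and> (\<forall>a b. c (a + b) = c a + c b) \<and>
    (\<forall>a b. c (a * b) = c a * c b) \<and> (\<forall>a x. x * c a = c a * x)"

text \<open>The universal property of the free algebra. The algebra structure of the target is the
  central map \<open>c\<close>, so complex numbers, matrices and the free algebra itself are all
  admissible targets.\<close>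

definition lift :: "(complex \<Rightarrow> 'b::ring_1) \<Rightarrow> ('g \<Rightarrow> 'b) \<Rightarrow> 'g falg \<Rightarrow> 'b"
  where "lift c f p =
    (\<Sum>m\<in>Poly_Mapping.keys p. c (Poly_Mapping.lookup p m) * prod_list (map f (letters m)))"

lemma update_eq_single_plus:
  "a \<notin> Poly_Mapping.keys p \<Longrightarrow> Poly_Mapping.update a b p = Poly_Mapping.single a b + p"
  for p :: "'a \<Rightarrow>\<^sub>0 'b::monoid_add"
  by (rule poly_mapping_eqI) (auto simp: lookup_update lookup_add lookup_single when_def in_keys_iff)

lemma const_commute: "x * const c = const c * x" for x :: "'g falg"
proof (induction x rule: update_induct)
  case (update f a b)
  then show ?case
    by (simp add: update_eq_single_plus distrib_left distrib_right const_def mult_single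
        mult.commute)
qed simp

lemma const_diff: "const (a - b) = const a - const b"
  by (simp add: const_def single_diff)

lemma const_left_commute: "x * (const c * y) = const c * (x * y)" for x :: "'g falg"
  by (metis const_commute mult.assoc)

text \<open>As rewrite rules these collect scalars to the left of the generators; the first two are
  permutative, so ordered rewriting sorts the scalars among themselves.\<close>

lemma const_normalize:
  "const a * const b = const b * (const a :: 'g falg)"
  "const a * (const b * x) = const b * (const a * (x :: 'g falg))"
  "gen g * const a = const a * gen g"
  "gen g * (const a * x) = const a * (gen g * x)"
  by (metis const_commute mult.assoc)+

lemma central_hom_const: "central_hom (const :: complex \<Rightarrow> 'g falg)"
  unfolding central_hom_def using const_simps const_commute by blast

lemma falg_induct [case_names const gen add mult]:
  assumes const: "\<And>c. P (const c)" and gen: "\<And>g. P (gen g)"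
    and add: "\<And>x y. P x \<Longrightarrow> P y \<Longrightarrow> P (x + y)"
    and mult: "\<And>x y. P x \<Longrightarrow> P y \<Longrightarrow> P (x * y)"
  shows "P (x :: 'g falg)"
proof -
  have word: "P (Poly_Mapping.single (Mon w) 1)" for w :: "'g list"
  proof (induction w)
    case Nil
    show ?case using const[of 1] by (simp add: const_def zero_mon_def)
  next
    case (Cons g w)
    have "Poly_Mapping.single (Mon (g # w)) 1 = gen g * Poly_Mapping.single (Mon w) (1::complex)"
      by (simp add: gen_def mult_single plus_mon_def)
    then show ?case using mult[OF gen Cons.IH] by simp
  qed
  show ?thesis
  proof (induction x rule: update_induct)
    case const
    show ?case using assms(1)[of 0] by (simp add: const_simps)
  next
    case (update f a b)
    have "Poly_Mapping.update a b f = const b * Poly_Mapping.single (Mon (letters a)) 1 + f"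
      using update.hyps by (simp add: update_eq_single_plus const_def mult_single)
    then show ?case using add[OF mult[OF const word] update.IH, of b "letters a"] by simp
  qed
qed

context
  fixes c :: "complex \<Rightarrow> 'b::ring_1" and f :: "'g \<Rightarrow> 'b"
  assumes c: "central_hom c"
begin

lemma central_hom_simps: "c 1 = 1" "c (a + b) = c a + c b" "c (a * b) = c a * c b"
  using c unfolding central_hom_def by blast+

lemma central_hom_commute: "x * c a = c a * x"
  using c unfolding central_hom_def by blast

lemma central_hom_zero: "c 0 = 0"
  using central_hom_simps(2)[of 0 0] by simp

text \<open>Summing over one finite set that contains the supports of \<open>x\<close>,
  \<open>y\<close> and \<open>x + y\<close> turns additivity into a termwise statement.\<close>

lemma lift_superset:
  assumes "finite S" "Poly_Mapping.keys p \<subseteq> S"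
  shows "lift c f p = (\<Sum>m\<in>S. c (Poly_Mapping.lookup p m) * prod_list (map f (letters m)))"
  unfolding lift_def using assms
  by (intro sum.mono_neutral_left) (auto simp: in_keys_iff central_hom_zero)

lemma lift_add: "lift c f (x + y) = lift c f x + lift c f y"
proof -
  let ?S = "Poly_Mapping.keys x \<union> Poly_Mapping.keys y"
  have "lift c f z = (\<Sum>m\<in>?S. c (Poly_Mapping.lookup z m) * prod_list (map f (letters m)))"
    if "z \<in> {x, y, x + y}" for z
    using that keys_add[of x y] by (intro lift_superset) auto
  then show ?thesis
    by (simp add: central_hom_simps lookup_add distrib_right sum.distrib)
qed

lemma lift_single: "lift c f (Poly_Mapping.single m a) = c a * prod_list (map f (letters m))"
  by (subst lift_superset[of "{m}"]) (auto simp: lookup_single)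

lemma lift_const [simp]: "lift c f (const a) = c a"
  using lift_single[of 0 a] by (simp add: const_def zero_mon_def)

lemma lift_gen [simp]: "lift c f (gen g) = f g"
  using lift_single[of "Mon [g]" 1] by (simp add: gen_def central_hom_simps)

lemma lift_mult: "lift c f (x * y) = lift c f x * lift c f y"
proof -
  have zero: "lift c f 0 = 0" by (simp add: lift_def)
  have single: "lift c f (Poly_Mapping.single m a * y) = lift c f (Poly_Mapping.single m a) * lift c f y"
    for m a
  proof (induction y rule: update_induct)
    case const
    show ?case by (simp add: zero)
  next
    case (update p k b)
    have "lift c f (Poly_Mapping.single m a * Poly_Mapping.single k b)
        = lift c f (Poly_Mapping.single m a) * lift c f (Poly_Mapping.single k b)"
      unfolding mult_single lift_single
      by (simp add: plus_mon_def central_hom_simps) (metis mult.assoc central_hom_commute)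
    with update show ?case by (simp add: update_eq_single_plus distrib_left lift_add)
  qed
  show ?thesis
  proof (induction x rule: update_induct)
    case const
    show ?case by (simp add: zero)
  next
    case (update p k b)
    then show ?case by (simp add: update_eq_single_plus distrib_right lift_add single)
  qed
qed

lemma lift_zero [simp]: "lift c f 0 = 0"
  by (simp add: lift_def)

lemma lift_one [simp]: "lift c f 1 = 1"
  using lift_const[of 1] by (simp add: const_simps central_hom_simps)

lemma lift_diff: "lift c f (x - y) = lift c f x - lift c f y"
  using lift_add[of "x - y" y] by simp

lemma lift_power: "lift c f (x ^ n) = lift c f x ^ n"
  by (induction n) (simp_all add: lift_mult)

end

section \<open>Quotient algebras\<close>

text \<open>Less than a module, but enough to make ideals into subspaces, and inherited by
  quotients; this allows a quotient to be taken twice.\<close>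

locale scalar_ring = ring A for A :: "(complex, 'a) module" (structure) +
  assumes smult_closed [intro, simp]: "x \<in> carrier A \<Longrightarrow> c \<odot> x \<in> carrier A"
    and smult_eq_mult: "x \<in> carrier A \<Longrightarrow> c \<odot> x = (c \<odot> \<one>) \<otimes> x"

lemma scalar_ring_free_alg: "scalar_ring free_alg"
  by (intro scalar_ring.intro ring_free_alg, unfold_locales) (simp_all add: free_alg_def)

lemma alg_homI:
  assumes "\<And>x. x \<in> carrier A \<Longrightarrow> h x \<in> carrier B"
    and "\<And>x y. x \<in> carrier A \<Longrightarrow> y \<in> carrier A \<Longrightarrow> h (x \<otimes>\<^bsub>A\<^esub> y) = h x \<otimes>\<^bsub>B\<^esub> h y"
    and "\<And>x y. x \<in> carrier A \<Longrightarrow> y \<in> carrier A \<Longrightarrow> h (x \<oplus>\<^bsub>A\<^esub> y) = h x \<oplus>\<^bsub>B\<^esub> h y"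
    and "h \<one>\<^bsub>A\<^esub> = \<one>\<^bsub>B\<^esub>"
    and "\<And>c x. x \<in> carrier A \<Longrightarrow> h (c \<odot>\<^bsub>A\<^esub> x) = c \<odot>\<^bsub>B\<^esub> h x"
  shows "h \<in> alg_hom A B"
  using assms by (auto simp: alg_hom_def ring_hom_def)

lemma alg_homD:
  assumes "h \<in> alg_hom A B"
  shows "x \<in> carrier A \<Longrightarrow> h x \<in> carrier B"
    and "x \<in> carrier A \<Longrightarrow> y \<in> carrier A \<Longrightarrow> h (x \<otimes>\<^bsub>A\<^esub> y) = h x \<otimes>\<^bsub>B\<^esub> h y"
    and "x \<in> carrier A \<Longrightarrow> y \<in> carrier A \<Longrightarrow> h (x \<oplus>\<^bsub>A\<^esub> y) = h x \<oplus>\<^bsub>B\<^esub> h y"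
    and "h \<one>\<^bsub>A\<^esub> = \<one>\<^bsub>B\<^esub>"
    and "x \<in> carrier A \<Longrightarrow> h (c \<odot>\<^bsub>A\<^esub> x) = c \<odot>\<^bsub>B\<^esub> h x"
  using assms by (auto simp: alg_hom_def ring_hom_def)

lemma alg_hom_comp:
  assumes "h \<in> alg_hom A B" "k \<in> alg_hom B C"
  shows "k \<circ> h \<in> alg_hom A C"
  by (rule alg_homI) (simp_all add: alg_homD[OF assms(1)] alg_homD[OF assms(2)])

text \<open>\<open>alg_quot\<close> copies the operations of a quotient ring into a different
  record, so the axioms have to be carried over field by field.\<close>

lemma ring_cong:
  assumes "ring R" "carrier S = carrier R" "mult S = mult R" "one S = one R"
    "zero S = zero R" "add S = add R"
  shows "ring S"
proof -
  interpret ring R by fact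
  show ?thesis
  proof (rule ringI)
    show "abelian_group S"
      by (rule abelian_groupI) (use assms(2-) a_assoc a_comm l_neg in \<open>auto intro: add.l_inv_ex\<close>)
    show "monoid S"
      by (rule monoidI) (use assms(2-) m_assoc in auto)
  qed (use assms(2-) l_distr r_distr in auto)
qed

context scalar_ring
begin

context
  fixes S assumes S: "S \<subseteq> carrier A"
begin

lemma ideal_Idl: "ideal (Idl S) A"
  using genideal_ideal[OF S] .

lemma ring_alg_quot: "ring (alg_quot A S)"
  by (rule ring_cong[OF ideal.quotient_is_ring[OF ideal_Idl]]) (simp_all add: alg_quot_def Let_def)

lemma quot_class_surj: "quot_class A S ` carrier A = carrier (alg_quot A S)"
  by (auto simp: alg_quot_def Let_def quot_class_def FactRing_def A_RCOSETS_defs a_r_coset_def)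

lemma quot_class_eq_iff:
  assumes "x \<in> carrier A" "y \<in> carrier A"
  shows "quot_class A S x = quot_class A S y \<longleftrightarrow> x \<ominus> y \<in> Idl S"
  using quotient_eq_iff_same_a_r_cos[OF ideal_Idl] assms
  by (simp add: quot_class_def)

lemma quot_class_ring_hom: "quot_class A S \<in> ring_hom A (alg_quot A S)"
  using ideal.rcos_ring_hom[OF ideal_Idl]
  by (simp add: ring_hom_def alg_quot_def Let_def quot_class_def Pi_def)

lemma quot_class_smult:
  assumes x: "x \<in> carrier A"
  shows "c \<odot>\<^bsub>alg_quot A S\<^esub> quot_class A S x = quot_class A S (c \<odot> x)"
proof -
  interpret ideal "Idl S" A by (rule ideal_Idl)
  \<comment> \<open>The scalar multiple is defined as a union over all representatives. They
    contribute the same coset, because scaling is multiplication by a fixed element and the class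
    map is multiplicative.\<close>
  have eq: "Idl S +> (c \<odot> y) = Idl S +> (c \<odot> x)" if "y \<in> Idl S +> x" for y
  proof -
    have y: "y \<in> carrier A" and cls: "quot_class A S y = quot_class A S x"
      using that x a_r_coset_subset_G[OF a_subset] a_repr_independence[OF that x a_subgroup]
      by (auto simp: quot_class_def)
    have one: "c \<odot> \<one> \<in> carrier A" by simp
    have "quot_class A S (c \<odot> y) = quot_class A S (c \<odot> x)"
      using y x cls one quot_class_ring_hom
      by (simp add: smult_eq_mult[of y] smult_eq_mult[of x] ring_hom_mult)
    then show ?thesis by (simp add: quot_class_def)
  qed
  have "x \<in> Idl S +> x" using x by (rule a_rcos_self)
  then have "(\<Union>y\<in>Idl S +> x. Idl S +> (c \<odot> y)) = Idl S +> (c \<odot> x)"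
    by (intro SUP_eq_const eq) auto
  then show ?thesis
    by (simp add: alg_quot_def Let_def quot_class_def)
qed

lemma quot_class_alg_hom: "quot_class A S \<in> alg_hom A (alg_quot A S)"
  using quot_class_ring_hom by (simp add: alg_hom_def quot_class_smult)

text \<open>Serves the iterated quotient: a kernel in the free algebra reaches \<open>AW3\<close>
  only through its image, and surjectivity of the class map makes the image absorb products.\<close>

lemma ideal_quot_class_image:
  assumes "ideal J A"
  shows "ideal (quot_class A S ` J) (alg_quot A S)"
proof (rule idealI)
  interpret J: ideal J A by fact
  interpret ring_hom_ring A "alg_quot A S" "quot_class A S"
    by (rule ring_hom_ringI2) (rule ring_axioms ring_alg_quot quot_class_ring_hom)+
  show "ring (alg_quot A S)" by (rule ring_alg_quot)
  show "subgroup (quot_class A S ` J) (add_monoid (alg_quot A S))"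
    by (rule img_is_add_subgroup[OF J.a_subgroup])
  fix X Y assume "X \<in> quot_class A S ` J" "Y \<in> carrier (alg_quot A S)"
  then obtain x y where xy: "x \<in> J" "X = quot_class A S x" "y \<in> carrier A" "Y = quot_class A S y"
    using quot_class_surj by blast
  then have x: "x \<in> carrier A" using J.Icarr by blast
  show "Y \<otimes>\<^bsub>alg_quot A S\<^esub> X \<in> quot_class A S ` J"
    using xy x J.I_l_closed by (simp flip: hom_mult)
  show "X \<otimes>\<^bsub>alg_quot A S\<^esub> Y \<in> quot_class A S ` J"
    using xy x J.I_r_closed by (simp flip: hom_mult)
qed

lemma scalar_ring_alg_quot: "scalar_ring (alg_quot A S)"
proof (intro scalar_ring.intro ring_alg_quot, unfold_locales)
  fix X c assume "X \<in> carrier (alg_quot A S)"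
  then obtain x where x: "x \<in> carrier A" "X = quot_class A S x"
    using quot_class_surj by blast
  note hom = alg_homD[OF quot_class_alg_hom]
  show "c \<odot>\<^bsub>alg_quot A S\<^esub> X \<in> carrier (alg_quot A S)"
    using x by (simp add: quot_class_smult hom(1))
  show "c \<odot>\<^bsub>alg_quot A S\<^esub> X = (c \<odot>\<^bsub>alg_quot A S\<^esub> \<one>\<^bsub>alg_quot A S\<^esub>) \<otimes>\<^bsub>alg_quot A S\<^esub> X"
    using x smult_eq_mult[of x c]
    by (simp add: quot_class_smult flip: hom(2,4))
qed

end

end

text \<open>One implication between the fibres makes the induced map well defined, the other makes
  it injective; the choice of a preimage in \<open>SOME\<close> is then immaterial.\<close>

lemma alg_iso_of_same_fibres:
  assumes p: "p \<in> alg_hom A B" "p ` carrier A = carrier B"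
    and p': "p' \<in> alg_hom A C" "p' ` carrier A = carrier C"
    and A: "ring A" "\<And>c x. x \<in> carrier A \<Longrightarrow> c \<odot>\<^bsub>A\<^esub> x \<in> carrier A"
    and fibres: "\<And>x y. x \<in> carrier A \<Longrightarrow> y \<in> carrier A \<Longrightarrow> p x = p y \<longleftrightarrow> p' x = p' y"
  shows "\<exists>\<phi>\<in>alg_iso B C. \<forall>x\<in>carrier A. \<phi> (p x) = p' x"
proof -
  interpret ring A by fact
  define \<phi> where "\<phi> = (\<lambda>X. p' (SOME x. x \<in> carrier A \<and> p x = X))"
  have \<phi>: "\<phi> (p x) = p' x" if "x \<in> carrier A" for x
    unfolding \<phi>_def by (rule someI2[of _ x]) (use that fibres in auto)
  have "\<phi> \<in> alg_hom B C"
  proof (rule alg_homI)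
    fix X Y c assume "X \<in> carrier B" "Y \<in> carrier B"
    then obtain x y where xy: "x \<in> carrier A" "X = p x" "y \<in> carrier A" "Y = p y" using p(2) by blast
    show "\<phi> (X \<otimes>\<^bsub>B\<^esub> Y) = \<phi> X \<otimes>\<^bsub>C\<^esub> \<phi> Y"
      using xy \<phi>[of "x \<otimes>\<^bsub>A\<^esub> y"] by (simp add: \<phi> alg_homD[OF p(1)] alg_homD[OF p'(1)])
    show "\<phi> (X \<oplus>\<^bsub>B\<^esub> Y) = \<phi> X \<oplus>\<^bsub>C\<^esub> \<phi> Y"
      using xy \<phi>[of "x \<oplus>\<^bsub>A\<^esub> y"] by (simp add: \<phi> alg_homD[OF p(1)] alg_homD[OF p'(1)])
  next
    fix X c assume "X \<in> carrier B"
    then obtain x where x: "x \<in> carrier A" "X = p x" using p(2) by blast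
    show "\<phi> X \<in> carrier C" using x by (simp add: \<phi> alg_homD[OF p'(1)])
    show "\<phi> (c \<odot>\<^bsub>B\<^esub> X) = c \<odot>\<^bsub>C\<^esub> \<phi> X"
      using x \<phi>[of "c \<odot>\<^bsub>A\<^esub> x"] A(2) by (simp add: \<phi> alg_homD[OF p(1)] alg_homD[OF p'(1)])
  next
    show "\<phi> \<one>\<^bsub>B\<^esub> = \<one>\<^bsub>C\<^esub>"
      using \<phi>[of "\<one>\<^bsub>A\<^esub>"] by (simp add: alg_homD[OF p(1)] alg_homD[OF p'(1)])
  qed
  moreover have "bij_betw \<phi> (carrier B) (carrier C)"
    unfolding bij_betw_def
  proof
    show "inj_on \<phi> (carrier B)"
      unfolding p(2)[symmetric] by (auto intro!: inj_onI simp: \<phi> fibres)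
    have "\<phi> ` carrier B = p' ` carrier A"
      unfolding p(2)[symmetric] image_image using \<phi> by simp
    then show "\<phi> ` carrier B = carrier C" by (simp add: p'(2))
  qed
  ultimately show ?thesis using \<phi> by (auto simp: alg_iso_def)
qed

section \<open>The two presented algebras and their class maps\<close>

lemma free_alg_simps [simp]:
  "carrier free_alg = UNIV" "x \<otimes>\<^bsub>free_alg\<^esub> y = x * y" "x \<oplus>\<^bsub>free_alg\<^esub> y = x + y"
  "\<one>\<^bsub>free_alg\<^esub> = 1" "\<zero>\<^bsub>free_alg\<^esub> = 0" "c \<odot>\<^bsub>free_alg\<^esub> x = const c * x"
  by (simp_all add: free_alg_def)

lemma free_alg_minus [simp]: "x \<ominus>\<^bsub>free_alg\<^esub> y = x - y"
proof -
  interpret ring free_alg by (rule ring_free_alg)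
  have "(x \<ominus>\<^bsub>free_alg\<^esub> y) \<oplus>\<^bsub>free_alg\<^esub> y = x"
    by (simp add: a_minus_def a_assoc l_neg del: free_alg_simps(3))
  then show ?thesis by (simp add: eq_diff_eq)
qed

interpretation free: scalar_ring free_alg
  by (rule scalar_ring_free_alg)

interpretation AW3: scalar_ring "AW3 q" for q
  unfolding AW3_def by (rule free.scalar_ring_alg_quot) simp

lemma onebTL2_class_alg_hom: "onebTL2_class q w \<in> alg_hom free_alg (onebTL2 q w)"
  unfolding onebTL2_def onebTL2_class_def by (rule free.quot_class_alg_hom) simp

lemma onebTL2_class_surj: "onebTL2_class q w ` UNIV = carrier (onebTL2 q w)"
  unfolding onebTL2_def onebTL2_class_def
  using free.quot_class_surj[of "onebTL2_rels q w"] by simp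

lemma AW3_class_alg_hom: "AW3_class q \<in> alg_hom free_alg (AW3 q)"
  unfolding AW3_def AW3_class_def by (rule free.quot_class_alg_hom) simp

lemma AW3_class_surj: "AW3_class q ` UNIV = carrier (AW3 q)"
  unfolding AW3_def AW3_class_def using free.quot_class_surj[of "AW3_rels q"] by simp

lemma AW3_class_image_subset: "AW3_class q ` X \<subseteq> carrier (AW3 q)"
  using AW3_class_surj by fast

lemma AW_bar_class_alg_hom: "AW_bar_class q j1 j2 j3 \<in> alg_hom free_alg (AW_bar q j1 j2 j3)"
proof -
  have "AW_bar_class q j1 j2 j3
      = quot_class (AW3 q) (AW3_class q ` AW_bar_rels q j1 j2 j3) \<circ> AW3_class q"
    by (simp add: AW_bar_class_def fun_eq_iff)
  then show ?thesis
    unfolding AW_bar_def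
    using alg_hom_comp[OF AW3_class_alg_hom AW3.quot_class_alg_hom[OF AW3_class_image_subset]]
    by simp
qed

lemma AW_bar_class_surj: "AW_bar_class q j1 j2 j3 ` UNIV = carrier (AW_bar q j1 j2 j3)"
  unfolding AW_bar_def AW_bar_class_def
    AW3.quot_class_surj[OF AW3_class_image_subset, symmetric] AW3_class_surj[symmetric]
  by (simp add: image_image)

text \<open>Congruences on a free algebra, presented by their class maps. They replace calculations in
  the quotient rings, whose carriers are not types.\<close>

locale falg_cong =
  fixes cl :: "'g falg \<Rightarrow> 'c"
  assumes cl_add: "cl x = cl x' \<Longrightarrow> cl y = cl y' \<Longrightarrow> cl (x + y) = cl (x' + y')"
    and cl_mult: "cl x = cl x' \<Longrightarrow> cl y = cl y' \<Longrightarrow> cl (x * y) = cl (x' * y')"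
begin

lemma cl_diff: "cl x = cl x' \<Longrightarrow> cl y = cl y' \<Longrightarrow> cl (x - y) = cl (x' - y')"
  using cl_add[of x x' "const (-1) * y" "const (-1) * y'"] cl_mult[of "const (-1)" "const (-1)" y y']
  by (simp add: const_def single_uminus)

lemma eq_iff_diff: "cl x = cl y \<longleftrightarrow> cl (x - y) = cl 0"
  using cl_diff[of x y y y] cl_add[of "x - y" 0 y y] by auto

lemma lmult_zero: "cl x = cl 0 \<Longrightarrow> cl (u * x) = cl 0"
  using cl_mult[of u u x 0] by simp

lemma rmult_zero: "cl x = cl 0 \<Longrightarrow> cl (x * u) = cl 0"
  using cl_mult[of x 0 u u] by simp

lemma scale_cancel: "cl (const a * x) = cl (const a * y) \<Longrightarrow> a \<noteq> 0 \<Longrightarrow> cl x = cl y"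
  using cl_mult[of "const (inverse a)" "const (inverse a)" "const a * x" "const a * y"]
  by (simp add: mult.assoc[symmetric] const_simps(4)[symmetric] const_simps)

lemma ideal_kernel: "ideal {x. cl x = cl 0} free_alg"
proof (rule idealI)
  show "subgroup {x. cl x = cl 0} (add_monoid free_alg)"
  proof (rule group.subgroupI)
    show "Group.group (add_monoid free_alg)" by (rule free.a_group)
  next
    fix x assume x: "x \<in> {x. cl x = cl 0}"
    have "inv\<^bsub>add_monoid free_alg\<^esub> x = - x"
      using free_alg_minus[of 0 x] free.minus_eq[of 0 x] by (simp add: a_inv_def)
    then show "inv\<^bsub>add_monoid free_alg\<^esub> x \<in> {x. cl x = cl 0}"
      using x cl_diff[of 0 0 x 0] by simp
  next
    fix x u assume "x \<in> {x. cl x = cl 0}" "u \<in> {x. cl x = cl 0}"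
    then show "x \<otimes>\<^bsub>add_monoid free_alg\<^esub> u \<in> {x. cl x = cl 0}"
      using cl_add[of x 0 u 0] by simp
  qed auto
qed (auto simp: lmult_zero rmult_zero ring_free_alg)

end

lemma falg_cong_lift:
  assumes "central_hom c"
  shows "falg_cong (lift c f)"
  by unfold_locales (simp_all add: lift_add[OF assms] lift_mult[OF assms])

lemma falg_cong_alg_hom:
  assumes "h \<in> alg_hom free_alg R"
  shows "falg_cong h"
  using alg_homD[OF assms] by unfold_locales (simp_all flip: free_alg_simps(2,3))

text \<open>The kernel of a congruence is an ideal, so with the relations it contains the whole
  ideal that they generate.\<close>

lemma onebTL2_class_eq_imp_eq:
  assumes "falg_cong cl" and rels: "\<And>s. s \<in> onebTL2_rels q w \<Longrightarrow> cl s = cl 0"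
    and eq: "onebTL2_class q w x = onebTL2_class q w y"
  shows "cl x = cl y"
proof -
  interpret falg_cong cl by fact
  have "x - y \<in> Idl\<^bsub>free_alg\<^esub> (onebTL2_rels q w)"
    using eq free.quot_class_eq_iff[of "onebTL2_rels q w" x y] by (simp add: onebTL2_class_def)
  also have "\<dots> \<subseteq> {x. cl x = cl 0}"
    using rels by (intro free.genideal_minimal ideal_kernel) auto
  finally show ?thesis by (simp add: eq_iff_diff[of x])
qed

text \<open>The quotient of a quotient has the universal property of a single quotient by both sets
  of relations.\<close>

lemma AW_bar_class_eq_imp_eq:
  assumes "falg_cong cl" and rels3: "\<And>s. s \<in> AW3_rels q \<Longrightarrow> cl s = cl 0"
    and rels: "\<And>s. s \<in> AW_bar_rels q j1 j2 j3 \<Longrightarrow> cl s = cl 0"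
    and eq: "AW_bar_class q j1 j2 j3 x = AW_bar_class q j1 j2 j3 y"
  shows "cl x = cl y"
proof -
  interpret falg_cong cl by fact
  let ?N = "{x. cl x = cl 0}"
  have Idl3: "Idl\<^bsub>free_alg\<^esub> (AW3_rels q) \<subseteq> ?N"
    using rels3 by (intro free.genideal_minimal ideal_kernel) auto
  note hom = alg_homD[OF AW3_class_alg_hom[of q]]
  have "ideal (AW3_class q ` ?N) (AW3 q)"
    unfolding AW3_def AW3_class_def
    by (rule free.ideal_quot_class_image) (simp_all add: ideal_kernel)
  then have "Idl\<^bsub>AW3 q\<^esub> (AW3_class q ` AW_bar_rels q j1 j2 j3) \<subseteq> AW3_class q ` ?N"
    using rels by (intro AW3.genideal_minimal) auto
  moreover have "AW3_class q x \<ominus>\<^bsub>AW3 q\<^esub> AW3_class q y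
      \<in> Idl\<^bsub>AW3 q\<^esub> (AW3_class q ` AW_bar_rels q j1 j2 j3)"
    using eq AW3.quot_class_eq_iff[OF AW3_class_image_subset, of "AW3_class q x" q "AW3_class q y"] hom(1)
    by (simp add: AW_bar_class_def)
  moreover have "AW3_class q x \<ominus>\<^bsub>AW3 q\<^esub> AW3_class q y = AW3_class q (x - y)"
  proof -
    have "AW3_class q x = AW3_class q (x - y) \<oplus>\<^bsub>AW3 q\<^esub> AW3_class q y"
      using hom(3)[of "x - y" y] by simp
    then show ?thesis using hom(1) by (simp add: AW3.minus_eq AW3.a_assoc AW3.r_neg)
  qed
  \<comment> \<open>Modulo the relations of \<open>AW3\<close> the difference \<open>x - y\<close>
    equals a kernel element \<open>z\<close>, and those relations lie in the kernel as well.\<close>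
  ultimately obtain z where z: "cl z = cl 0" "AW3_class q (x - y) = AW3_class q z" by auto
  then have "x - y - z \<in> Idl\<^bsub>free_alg\<^esub> (AW3_rels q)"
    using free.quot_class_eq_iff[of "AW3_rels q" "x - y" z] by (simp add: AW3_class_def)
  then have "cl (x - y - z) = cl 0" using Idl3 by blast
  with z(1) show ?thesis using eq_iff_diff by metis
qed

lemma onebTL2_class_rel:
  assumes "s \<in> onebTL2_rels q w"
  shows "onebTL2_class q w s = onebTL2_class q w 0"
  unfolding onebTL2_class_def
  by (subst free.quot_class_eq_iff) (use assms free.genideal_self in auto)

lemma AW_bar_class_rel:
  assumes "s \<in> AW3_rels q \<union> AW_bar_rels q j1 j2 j3"
  shows "AW_bar_class q j1 j2 j3 s = AW_bar_class q j1 j2 j3 0"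
proof (cases "s \<in> AW3_rels q")
  case True
  then have "AW3_class q s = AW3_class q 0"
    unfolding AW3_class_def
    by (subst free.quot_class_eq_iff) (use free.genideal_self in auto)
  then show ?thesis by (simp add: AW_bar_class_def)
next
  case False
  note hom = alg_homD[OF AW3_class_alg_hom[of q]]
  have "AW3_class q 0 = \<zero>\<^bsub>AW3 q\<^esub>"
    using hom(3)[of 0 0] hom(1)[of 0] AW3.add.l_cancel_one[of "AW3_class q 0" q "AW3_class q 0"]
    by simp
  then have "AW3_class q s \<ominus>\<^bsub>AW3 q\<^esub> AW3_class q 0 = AW3_class q s"
    using hom(1)[of s] by (simp add: AW3.minus_eq)
  moreover have "AW3_class q s \<in> Idl\<^bsub>AW3 q\<^esub> (AW3_class q ` AW_bar_rels q j1 j2 j3)"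
    using False assms AW3.genideal_self[OF AW3_class_image_subset] by auto
  ultimately show ?thesis
    unfolding AW_bar_class_def
    by (subst AW3.quot_class_eq_iff[OF AW3_class_image_subset]) (use hom(1) in auto)
qed

lemma alg_hom_agree:
  assumes h: "h \<in> alg_hom free_alg R" and h': "h' \<in> alg_hom free_alg R"
  shows "h (const c) = h' (const c)"
    and "h x = h' x \<Longrightarrow> h y = h' y \<Longrightarrow> h (x + y) = h' (x + y)"
    and "h x = h' x \<Longrightarrow> h y = h' y \<Longrightarrow> h (x * y) = h' (x * y)"
  using alg_homD(2,3)[OF h, of x y] alg_homD(2,3)[OF h', of x y]
    alg_homD(5)[OF h, of 1 c] alg_homD(5)[OF h', of 1 c] alg_homD(4)[OF h] alg_homD(4)[OF h']
  by simp_all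

lemma alg_hom_eqI:
  assumes "h \<in> alg_hom free_alg R" "h' \<in> alg_hom free_alg R"
    and "\<And>s. h (gen s) = h' (gen s)"
  shows "h x = h' x"
  by (induction x rule: falg_induct) (use assms alg_hom_agree in blast)+

lemma lift_alg_hom: "lift const f \<in> alg_hom free_alg free_alg"
  by (intro alg_homI) (simp_all add: lift_mult[OF central_hom_const] lift_add[OF central_hom_const]
      lift_one[OF central_hom_const] lift_const[OF central_hom_const])

section \<open>Three representations of the one-boundary Temperley--Lieb algebra\<close>

text \<open>The target of \<open>lift\<close> must be a type in class \<open>ring_1\<close>;
  explicit entries let matrix identities split into four scalar ones.\<close>

datatype mat2 = Mat2 complex complex complex complex

instantiation mat2 :: ring_1
begin
definition zero_mat2 :: mat2 where "0 = Mat2 0 0 0 0"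
definition one_mat2 :: mat2 where "1 = Mat2 1 0 0 1"
definition uminus_mat2 :: "mat2 \<Rightarrow> mat2"
  where "- x = (case x of Mat2 a b c d \<Rightarrow> Mat2 (- a) (- b) (- c) (- d))"
definition plus_mat2 :: "mat2 \<Rightarrow> mat2 \<Rightarrow> mat2"
  where "x + y = (case (x, y) of (Mat2 a b c d, Mat2 a' b' c' d') \<Rightarrow>
    Mat2 (a + a') (b + b') (c + c') (d + d'))"
definition minus_mat2 :: "mat2 \<Rightarrow> mat2 \<Rightarrow> mat2"
  where "x - y = (case (x, y) of (Mat2 a b c d, Mat2 a' b' c' d') \<Rightarrow>
    Mat2 (a - a') (b - b') (c - c') (d - d'))"
definition times_mat2 :: "mat2 \<Rightarrow> mat2 \<Rightarrow> mat2"
  where "x * y = (case (x, y) of (Mat2 a b c d, Mat2 a' b' c' d') \<Rightarrow>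
    Mat2 (a * a' + b * c') (a * b' + b * d') (c * a' + d * c') (c * b' + d * d'))"
instance
  by standard
    (auto simp: zero_mat2_def one_mat2_def uminus_mat2_def plus_mat2_def minus_mat2_def
      times_mat2_def algebra_simps split: mat2.splits)
end

lemma mat2_simps [simp]:
  "Mat2 a b c d + Mat2 a' b' c' d' = Mat2 (a + a') (b + b') (c + c') (d + d')"
  "Mat2 a b c d - Mat2 a' b' c' d' = Mat2 (a - a') (b - b') (c - c') (d - d')"
  "Mat2 a b c d * Mat2 a' b' c' d' =
    Mat2 (a * a' + b * c') (a * b' + b * d') (c * a' + d * c') (c * b' + d * d')"
  by (simp_all add: plus_mat2_def minus_mat2_def times_mat2_def)

definition scalar_mat2 :: "complex \<Rightarrow> mat2"
  where "scalar_mat2 a = Mat2 a 0 0 a"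

lemma central_hom_scalar_mat2: "central_hom scalar_mat2"
  by (auto simp: central_hom_def scalar_mat2_def one_mat2_def times_mat2_def mult.commute
      split: mat2.splits)

lemma central_hom_id: "central_hom (\<lambda>a. a)"
  by (auto simp: central_hom_def mult.commute)

lemmas lift_hom_simps =
  lift_add lift_diff lift_mult lift_power lift_const lift_gen lift_zero lift_one

lemmas lift_mat2 = lift_hom_simps[OF central_hom_scalar_mat2]
lemmas lift_complex = lift_hom_simps[OF central_hom_id]

text \<open>The algebra with \<open>\<sigma>\<^sub>0\<^sup>2 = t \<sigma>\<^sub>0\<close>, \<open>\<sigma>\<^sub>1\<^sup>2 = d \<sigma>\<^sub>1\<close> and \<open>\<sigma>\<^sub>1\<sigma>\<^sub>0\<sigma>\<^sub>1 = \<sigma>\<^sub>1\<close> acts on the left ideal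
  generated by \<open>\<sigma>\<^sub>1\<close>, with basis \<open>\<sigma>\<^sub>1\<close>, \<open>\<sigma>\<^sub>0\<sigma>\<^sub>1\<close>, through \<open>tl_mat\<close>; the characters \<open>tl_char 0\<close>
  and \<open>tl_char t\<close> are the ones killing \<open>\<sigma>\<^sub>1\<close>.\<close>

fun tl_mat :: "complex \<Rightarrow> complex \<Rightarrow> tl_gen \<Rightarrow> mat2" where
  "tl_mat t d Sigma0 = Mat2 0 0 1 t"
| "tl_mat t d Sigma1 = Mat2 d 1 0 0"

fun tl_char :: "complex \<Rightarrow> tl_gen \<Rightarrow> complex" where
  "tl_char a Sigma0 = a"
| "tl_char a Sigma1 = 0"

text \<open>The words containing \<open>sigma1\<close> at most once and no
  \<open>sigma0 * sigma0\<close>: the relations shorten all others. Their number 6 = 1 + 1 + 4 is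
  the total dimension of the targets of the three representations.\<close>

definition tl_word_comb ::
    "complex \<Rightarrow> complex \<Rightarrow> complex \<Rightarrow> complex \<Rightarrow> complex \<Rightarrow> complex \<Rightarrow> tl_gen falg"
  where "tl_word_comb a b c e f g = const a + const b * sigma0 + const c * sigma1
    + const e * (sigma0 * sigma1) + const f * (sigma1 * sigma0) + const g * (sigma0 * sigma1 * sigma0)"

locale tl_cong = falg_cong cl for cl :: "tl_gen falg \<Rightarrow> 'c" +
  fixes t d :: complex
  assumes sigma0_sq: "cl (sigma0 * sigma0) = cl (const t * sigma0)"
    and sigma1_sq: "cl (sigma1 * sigma1) = cl (const d * sigma1)"
    and sigma101: "cl (sigma1 * sigma0 * sigma1) = cl sigma1"
begin

lemma sigma0_word_comb:
  "cl (sigma0 * tl_word_comb a b c e f g) = cl (tl_word_comb 0 (a + b * t) 0 (c + e * t) 0 (f + g * t))"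
proof -
  have "cl (sigma0 * tl_word_comb a b c e f g)
    = cl (const a * sigma0 + const b * (sigma0 * sigma0) + const c * (sigma0 * sigma1)
       + const e * ((sigma0 * sigma0) * sigma1) + const f * (sigma0 * sigma1 * sigma0)
       + const g * ((sigma0 * sigma0) * sigma1 * sigma0))"
    by (rule arg_cong[of _ _ cl])
      (simp add: tl_word_comb_def distrib_left const_commute[of sigma0] mult.assoc[symmetric])
  also have "\<dots> = cl (const a * sigma0 + const b * (const t * sigma0) + const c * (sigma0 * sigma1)
       + const e * ((const t * sigma0) * sigma1) + const f * (sigma0 * sigma1 * sigma0)
       + const g * ((const t * sigma0) * sigma1 * sigma0))"
    by (intro cl_add cl_mult refl sigma0_sq)
  also have "\<dots> = cl (tl_word_comb 0 (a + b * t) 0 (c + e * t) 0 (f + g * t))"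
    by (rule arg_cong[of _ _ cl]) (simp add: tl_word_comb_def const_simps const_normalize algebra_simps)
  finally show ?thesis .
qed

lemma sigma1_word_comb:
  "cl (sigma1 * tl_word_comb a b c e f g) = cl (tl_word_comb 0 0 (a + c * d + e) 0 (b + f * d + g) 0)"
proof -
  have "cl (sigma1 * tl_word_comb a b c e f g)
    = cl (const a * sigma1 + const b * (sigma1 * sigma0) + const c * (sigma1 * sigma1)
       + const e * (sigma1 * sigma0 * sigma1) + const f * ((sigma1 * sigma1) * sigma0)
       + const g * ((sigma1 * sigma0 * sigma1) * sigma0))"
    by (rule arg_cong[of _ _ cl])
      (simp add: tl_word_comb_def distrib_left const_commute[of sigma1] mult.assoc[symmetric])
  also have "\<dots> = cl (const a * sigma1 + const b * (sigma1 * sigma0) + const c * (const d * sigma1)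
       + const e * sigma1 + const f * ((const d * sigma1) * sigma0) + const g * (sigma1 * sigma0))"
    by (intro cl_add cl_mult refl sigma1_sq sigma101)
  also have "\<dots> = cl (tl_word_comb 0 0 (a + c * d + e) 0 (b + f * d + g) 0)"
    by (rule arg_cong[of _ _ cl]) (simp add: tl_word_comb_def const_simps const_normalize algebra_simps)
  finally show ?thesis .
qed

definition spanned :: "tl_gen falg \<Rightarrow> bool"
  where "spanned x \<longleftrightarrow> (\<exists>a b c e f g. cl x = cl (tl_word_comb a b c e f g))"

lemma spannedI: "cl x = cl (tl_word_comb a b c e f g) \<Longrightarrow> spanned x"
  unfolding spanned_def by blast

text \<open>The span is a left ideal; as it contains 1, it is everything.\<close>

lemma spanned_mult: "spanned y \<Longrightarrow> spanned (x * y)"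
proof (induction x arbitrary: y rule: falg_induct)
  case (const k)
  then obtain a b c e f g where "cl y = cl (tl_word_comb a b c e f g)" by (auto simp: spanned_def)
  then have "cl (const k * y) = cl (const k * tl_word_comb a b c e f g)" by (intro cl_mult refl)
  also have "const k * tl_word_comb a b c e f g
      = tl_word_comb (k * a) (k * b) (k * c) (k * e) (k * f) (k * g)"
    by (simp add: tl_word_comb_def const_simps const_normalize algebra_simps)
  finally show ?case unfolding spanned_def by blast
next
  case (gen s)
  then obtain a b c e f g where "cl y = cl (tl_word_comb a b c e f g)" by (auto simp: spanned_def)
  then have *: "cl (gen s * y) = cl (gen s * tl_word_comb a b c e f g)" by (intro cl_mult refl)
  show ?case
    using * sigma0_word_comb[of a b c e f g] sigma1_word_comb[of a b c e f g]
    by (cases s) (metis spannedI)+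
next
  case (add u v)
  obtain a b c e f g where 1: "cl (u * y) = cl (tl_word_comb a b c e f g)"
    using add.IH(1)[OF add.prems] by (auto simp: spanned_def)
  obtain a' b' c' e' f' g' where 2: "cl (v * y) = cl (tl_word_comb a' b' c' e' f' g')"
    using add.IH(2)[OF add.prems] by (auto simp: spanned_def)
  have "cl ((u + v) * y) = cl (tl_word_comb a b c e f g + tl_word_comb a' b' c' e' f' g')"
    unfolding distrib_right by (intro cl_add 1 2)
  also have "tl_word_comb a b c e f g + tl_word_comb a' b' c' e' f' g'
      = tl_word_comb (a + a') (b + b') (c + c') (e + e') (f + f') (g + g')"
    by (simp add: tl_word_comb_def const_simps const_normalize algebra_simps)
  finally show ?case unfolding spanned_def by blast
next
  case (mult u v)
  then show ?case by (simp add: mult.assoc)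
qed

lemma spanned_all: "spanned x"
proof -
  have "1 = tl_word_comb 1 0 0 0 0 0" by (simp add: tl_word_comb_def const_simps)
  then have "spanned 1" unfolding spanned_def by metis
  from spanned_mult[OF this, of x] show ?thesis by simp
qed

text \<open>The characters kill every word containing \<open>sigma1\<close> and so read off the
  coefficients of 1 and \<open>sigma0\<close>. The matrix entries then give the same 2 by 2 linear
  system for \<open>c\<close>, \<open>f\<close> and for \<open>e\<close>, \<open>g\<close>, with
  determinant \<open>d * t - 1\<close>.\<close>

lemma cl_zeroI:
  assumes "t \<noteq> 0" "d * t \<noteq> 1"
    and char_cong: "\<And>x y a. cl x = cl y \<Longrightarrow> a \<in> {0, t} \<Longrightarrow>
      lift (\<lambda>c. c) (tl_char a) x = lift (\<lambda>c. c) (tl_char a) y"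
    and mat_cong: "\<And>x y. cl x = cl y \<Longrightarrow>
      lift scalar_mat2 (tl_mat t d) x = lift scalar_mat2 (tl_mat t d) y"
    and x: "lift (\<lambda>c. c) (tl_char 0) x = 0" "lift (\<lambda>c. c) (tl_char t) x = 0"
      "lift scalar_mat2 (tl_mat t d) x = 0"
  shows "cl x = cl 0"
proof -
  obtain a b c e f g where eq: "cl x = cl (tl_word_comb a b c e f g)"
    using spanned_all[of x] by (auto simp: spanned_def)
  have "a = 0" "b = 0"
    using char_cong[OF eq, of 0] char_cong[OF eq, of t] x \<open>t \<noteq> 0\<close>
    by (simp_all add: tl_word_comb_def lift_complex)
  moreover have "lift scalar_mat2 (tl_mat t d) (tl_word_comb 0 0 c e f g)
      = Mat2 (c * d + f) (c + f * t) (e * d + g) (e + g * t)"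
    by (simp add: tl_word_comb_def lift_mat2 scalar_mat2_def)
  ultimately have "Mat2 (c * d + f) (c + f * t) (e * d + g) (e + g * t) = 0"
    using mat_cong[OF eq] x(3) by simp
  then have "c * d + f = 0" "c + f * t = 0" "e * d + g = 0" "e + g * t = 0"
    unfolding zero_mat2_def mat2.inject by blast+
  moreover have "u = 0 \<and> v = 0" if "u * d + v = 0" "u + v * t = 0" for u v
  proof -
    have "u * (1 - d * t) = (u + v * t) - (u * d + v) * t" by (simp add: algebra_simps)
    then show ?thesis using that \<open>d * t \<noteq> 1\<close> by simp
  qed
  ultimately have "c = 0 \<and> f = 0" "e = 0 \<and> g = 0" by blast+
  with \<open>a = 0\<close> \<open>b = 0\<close> eq show ?thesis by (simp add: tl_word_comb_def const_simps)
qed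

end

section \<open>Consequences of the relations of the quotient of the Askey--Wilson algebra\<close>

lemma aprod_linear_insert:
  assumes "finite M" "m \<notin> M"
  shows "aprod (\<lambda>m. x - const (f m)) (insert m M) = (x - const (f m)) * aprod (\<lambda>m. x - const (f m)) M"
proof (rule aprod_insert[OF assms])
  show "(x - const (f a)) * (x - const (f b)) = (x - const (f b)) * (x - const (f a))" for a b
    by (simp add: algebra_simps const_commute[of x] const_normalize)
qed

text \<open>Notation for the numbers in the quotient with \<open>j\<^sub>2 = j\<^sub>3 = 1/2\<close>: \<open>al\<close> and \<open>be\<close> are the
  values of \<open>\<alpha>\<^sub>1 = \<chi>\<^sub>j\<close> and \<open>\<alpha>\<^sub>2 = \<alpha>\<^sub>3\<close>; the eigenvalues of \<open>A\<close> and \<open>D\<close> are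
  \<open>a1\<close>, \<open>a2\<close>, those of \<open>B\<close> are \<open>b1\<close>, \<open>b3\<close>, and those of \<open>K\<close> are \<open>k1\<close>, \<open>al\<close>, \<open>k3\<close>.\<close>

locale aw_cong = falg_cong cl for cl :: "aw_gen falg \<Rightarrow> 'c" +
  fixes q r m w al be a1 a2 b1 b3 k1 k3 :: complex and M :: "complex set"
  assumes K_commute: "cl (aK * gen g) = cl (gen g * aK)"
    and rel2: "cl (aB + const m * (const q * aD * aA - const r * aA * aD))
      = cl (const w * (const (be * be) + const al * aK))"
    and rel3: "cl (aD + const m * (const q * aA * aB - const r * aB * aA))
      = cl (const w * (const (al * be) + const be * aK))"
    and A_quad: "cl ((aA - const a1) * (aA - const a2)) = cl 0"
    and B_quad: "cl ((aB - const b1) * (aB - const b3)) = cl 0"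
    and D_quad: "cl ((aD - const a1) * (aD - const a2)) = cl 0"
    and K_cubic: "cl ((aK - const k1) * ((aK - const al) * (aK - const k3))) = cl 0"
    and KA: "cl (aprod (\<lambda>x. aK - aA - const x) M) = cl 0"
    and KD: "cl (aprod (\<lambda>x. aK - aD - const x) M) = cl 0"
    and M: "finite M" "k1 - a2 \<notin> M" "k3 - a1 \<notin> M"
    and edge1: "b3 = w * (be * be + al * k1) - m * (q - r) * a1\<^sup>2"
    and edge3: "b3 = w * (be * be + al * k3) - m * (q - r) * a2\<^sup>2"
    and k_neq: "k1 \<noteq> k3"
    and qr: "q * r = 1" and mb: "m * (q - r) * b1 = 1" and bb: "(q\<^sup>2 + r\<^sup>2) * b1 = b1 + b3"
    and mbb: "m\<^sup>2 * (b3 - b1) * b1 = 1"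
    and mw: "m * (q - r) = w"
    and centre: "a1 + a2 \<noteq> 2 * w * al * be"
begin

text \<open>\<open>u\<close> plays the part of a left eigenvector: a simultaneous eigenvector of
  \<open>x\<close> and \<open>y\<close> is one of their product.\<close>

lemma eigen_mult:
  assumes "cl (u * x) = cl (const k * u)" "cl (u * y) = cl (const l * u)"
  shows "cl (u * (x * y)) = cl (const (k * l) * u)"
proof -
  have "cl (u * x * y) = cl (const k * u * y)" by (intro cl_mult assms refl)
  also have "const k * u * y = const k * (u * y)" by (simp add: mult.assoc)
  also have "cl \<dots> = cl (const k * (const l * u))" by (intro cl_mult assms refl)
  finally show ?thesis by (simp add: mult.assoc const_simps)
qed

text \<open>On a joint eigenvector of \<open>x\<close> and \<open>K\<close> the product becomes a
  number, none of whose factors vanishes.\<close>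

lemma eigen_aprod_zero:
  assumes x: "cl (u * x) = cl (const a * u)" and k: "cl (u * aK) = cl (const k * u)"
    and prod: "cl (aprod (\<lambda>m. aK - x - const m) S) = cl 0"
    and S: "finite S" "k - a \<notin> S"
  shows "cl u = cl 0"
proof -
  have "cl (u * aprod (\<lambda>m. aK - x - const m) S) = cl (const (\<Prod>m\<in>S. k - a - m) * u)"
    using \<open>finite S\<close>
  proof (induction S rule: finite_induct)
    case empty
    show ?case by (simp add: aprod_empty const_simps)
  next
    case (insert i F)
    have "cl (u * (aK - x - const i)) = cl (const k * u - const a * u - const i * u)"
      unfolding right_diff_distrib const_commute[of u] by (intro cl_diff x k refl)
    also have "const k * u - const a * u - const i * u = const (k - a - i) * u"
      by (simp add: const_simps const_diff algebra_simps)
    finally have "cl (u * (aK - x - const i)) = cl (const (k - a - i) * u)" .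
    from eigen_mult[OF this insert.IH] show ?case
      using insert.hyps by (simp add: aprod_linear_insert[where f = "\<lambda>m. m"])
  qed
  also have "cl (u * aprod (\<lambda>m. aK - x - const m) S) = cl 0"
    using lmult_zero[OF prod] .
  finally have "cl (const (\<Prod>m\<in>S. k - a - m) * u) = cl (const (\<Prod>m\<in>S. k - a - m) * 0)"
    by simp
  then show ?thesis
    by (rule scale_cancel) (use S in auto)
qed

lemma K_central: "cl (aK * x) = cl (x * aK)"
proof (induction x rule: falg_induct)
  case (const c)
  show ?case by (simp add: const_commute)
next
  case (gen g)
  show ?case by (rule K_commute)
next
  case (add x y)
  then show ?case unfolding distrib_left distrib_right by (rule cl_add)
next
  case (mult x y)
  have "cl (aK * x * y) = cl (x * aK * y)" by (intro cl_mult mult refl)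
  also have "x * aK * y = x * (aK * y)" by (simp add: mult.assoc)
  also have "cl \<dots> = cl (x * (y * aK))" by (intro cl_mult mult refl)
  finally show ?case by (simp add: mult.assoc)
qed

text \<open>The element \<open>e\<close> cuts out the eigenspace \<open>K = k\<close> at an extreme
  eigenvalue. There \<open>a'\<close> is excluded as an eigenvalue, so \<open>A\<close> and
  \<open>D\<close> both act as \<open>a\<close>; the second relation then expresses \<open>B\<close>
  by numbers, and the number is \<open>b3\<close>.\<close>

lemma edge:
  assumes cubic: "cl ((aK - const k) * ((aK - const al) * (aK - const k'))) = cl 0"
    and A: "cl ((aA - const a) * (aA - const a')) = cl 0"
    and D: "cl ((aD - const a) * (aD - const a')) = cl 0"
    and k: "k - a' \<notin> M" and b3: "b3 = w * (be * be + al * k) - m * (q - r) * a\<^sup>2"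
  shows "cl ((aK - const al) * (aK - const k') * (const b3 - aB)) = cl 0"
proof -
  define e where "e = (aK - const al) * (aK - const k')"
  note nf = const_simps const_diff const_normalize const_left_commute[of e] const_commute[of e]
    algebra_simps
  have "e * aK - const k * e = (aK - const k) * ((aK - const al) * (aK - const k'))"
    by (simp add: e_def const_simps const_diff const_normalize algebra_simps)
  then have eK: "cl (e * aK) = cl (const k * e)"
    using cubic eq_iff_diff by metis
  have cut: "cl (e * x) = cl (const a * e)"
    if x: "cl ((x - const a) * (x - const a')) = cl 0"
      and prod: "cl (aprod (\<lambda>m. aK - x - const m) M) = cl 0" for x
  proof -
    \<comment> \<open>A joint eigenvector with \<open>x = a'\<close> and \<open>K = k\<close>, a
      combination that the product over \<open>M\<close> forbids.\<close>
    define u where "u = e * (x - const a)"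
    have "u * x - const a' * u = e * ((x - const a) * (x - const a'))"
      by (simp add: u_def nf const_left_commute[of x] const_commute[of x])
    then have ux: "cl (u * x) = cl (const a' * u)"
      using lmult_zero[OF x, of e] eq_iff_diff by metis
    have "cl (u * aK) = cl (e * (aK * (x - const a)))"
      unfolding u_def mult.assoc by (intro cl_mult refl K_central[symmetric])
    also have "\<dots> = cl (e * aK * (x - const a))" by (simp add: mult.assoc)
    also have "\<dots> = cl (const k * e * (x - const a))" by (intro cl_mult refl eK)
    finally have "cl (u * aK) = cl (const k * u)" by (simp add: u_def mult.assoc)
    from eigen_aprod_zero[OF ux this prod M(1) k] show ?thesis
      unfolding u_def right_diff_distrib const_commute[of e] using eq_iff_diff by metis
  qed
  note eA = cut[OF A KA] and eD = cut[OF D KD]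
  have "cl (e * aB) = cl (e * (const w * (const (be * be) + const al * aK)
      - const m * (const q * aD * aA - const r * aA * aD)))"
    using cl_diff[OF rel2 refl, of "const m * (const q * aD * aA - const r * aA * aD)"]
    by (intro cl_mult refl) simp
  also have "\<dots> = cl (const (w * be * be) * e + const (w * al) * (e * aK)
      - (const (m * q) * (e * (aD * aA)) - const (m * r) * (e * (aA * aD))))"
    by (rule arg_cong[of _ _ cl]) (simp add: nf)
  also have "\<dots> = cl (const (w * be * be) * e + const (w * al) * (const k * e)
      - (const (m * q) * (const (a * a) * e) - const (m * r) * (const (a * a) * e)))"
    by (intro cl_add cl_mult cl_diff refl eK eigen_mult eA eD)
  also have "\<dots> = cl (const b3 * e)"
    by (rule arg_cong[of _ _ cl]) (simp add: nf b3 power2_eq_square)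
  finally have "cl (e * aB) = cl (const b3 * e)" .
  moreover have "e * (const b3 - aB) = const b3 * e - e * aB"
    by (simp add: right_diff_distrib const_commute[of e])
  ultimately have "cl (e * (const b3 - aB)) = cl 0"
    using eq_iff_diff by metis
  then show ?thesis by (simp only: e_def)
qed

text \<open>Subtracting the two extreme cases cancels \<open>K\<close> in the middle factor and
  leaves the nonzero number \<open>k3 - k1\<close>.\<close>

lemma K_on_sigma1: "cl ((aK - const al) * (const b3 - aB)) = cl 0"
proof -
  have "cl ((aK - const al) * (aK - const k3) * (const b3 - aB)) = cl 0"
    by (rule edge[OF K_cubic A_quad D_quad M(2) edge1])
  moreover have "cl ((aK - const al) * (aK - const k1) * (const b3 - aB)) = cl 0"
  proof (rule edge[OF _ _ _ M(3) edge3])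
    have "(aK - const k3) * ((aK - const al) * (aK - const k1))
        = (aK - const k1) * ((aK - const al) * (aK - const k3))"
      by (simp add: const_normalize algebra_simps)
    then show "cl ((aK - const k3) * ((aK - const al) * (aK - const k1))) = cl 0"
      using K_cubic by simp
    have swap: "(x - const a2) * (x - const a1) = (x - const a1) * (x - const a2)"
      for x :: "aw_gen falg"
      by (simp add: const_normalize const_commute[of x] algebra_simps)
    show "cl ((aA - const a2) * (aA - const a1)) = cl 0"
      "cl ((aD - const a2) * (aD - const a1)) = cl 0"
      using A_quad D_quad by (simp_all add: swap)
  qed
  ultimately have "cl ((aK - const al) * (aK - const k1) * (const b3 - aB)
      - (aK - const al) * (aK - const k3) * (const b3 - aB)) = cl (0 - 0)"
    by (intro cl_diff)
  also have "(aK - const al) * (aK - const k1) * (const b3 - aB)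
      - (aK - const al) * (aK - const k3) * (const b3 - aB)
      = const (k3 - k1) * ((aK - const al) * (const b3 - aB))"
    by (simp add: const_diff const_normalize algebra_simps)
  finally have "cl (const (k3 - k1) * ((aK - const al) * (const b3 - aB))) = cl (const (k3 - k1) * 0)"
    by simp
  then show ?thesis by (rule scale_cancel) (use k_neq in simp)
qed

text \<open>With \<open>p = b3 - B\<close>, proportional to the projection onto \<open>B = b1\<close>, the quadratic relation of
  \<open>D\<close> compressed by \<open>p\<close> is linear in \<open>p A p\<close>, because the terms containing \<open>p A B A p\<close> cancel.\<close>

lemma corner:
  defines "p \<equiv> const b3 - aB"
  shows "cl (p * aA * p) = cl (const (w * al * be) * (p * p))"
proof -
  \<comment> \<open>The value of the right side of the third relation at \<open>K = al\<close>,
    which is how \<open>K\<close> acts next to \<open>p\<close>. It is written as a sum so that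
    \<open>const\<close> distributes over it.\<close>
  define d0 where "d0 = w * al * be + w * al * be"
  have centre': "a1 + a2 - d0 \<noteq> 0" using centre by (simp add: d0_def ac_simps)
  have d0: "const d0 = const (w * al * be) + const (w * al * be)"
    by (simp only: d0_def const_simps)
  note pnf = const_left_commute[of p] const_commute[of p]
  note nf = const_simps const_diff const_normalize pnf algebra_simps
  \<comment> \<open>The quadratic relation of \<open>B\<close> makes \<open>p\<close> vanish on
    \<open>B = b3\<close>, so \<open>B\<close> acts as \<open>b1\<close> on either side of
    \<open>p\<close>.\<close>
  have "const b1 * p - p * aB = (aB - const b1) * (aB - const b3)"
    "const b1 * p - aB * p = (aB - const b1) * (aB - const b3)"
    by (simp_all add: p_def const_normalize algebra_simps)
  then have pB: "cl (p * aB) = cl (const b1 * p)" and Bp: "cl (aB * p) = cl (const b1 * p)"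
    using B_quad eq_iff_diff by metis+
  have "aK * p - const al * p = (aK - const al) * p" by (simp add: algebra_simps)
  then have Kp: "cl (aK * p) = cl (const al * p)"
    using K_on_sigma1 eq_iff_diff unfolding p_def by metis
  then have pK: "cl (p * aK) = cl (const al * p)"
    using K_central by metis
  have D: "cl aD = cl (const w * (const (al * be) + const be * aK)
      - const m * (const q * aA * aB - const r * aB * aA))"
    using cl_diff[OF rel3 refl, of "const m * (const q * aA * aB - const r * aB * aA)"] by simp
  have "cl (p * aD) = cl (p * (const w * (const (al * be) + const be * aK)
      - const m * (const q * aA * aB - const r * aB * aA)))"
    by (intro cl_mult refl D)
  also have "\<dots> = cl (const (w * al * be) * p + const (w * be) * (p * aK)
      - (const (m * q) * (p * aA * aB) - const (m * r) * (p * aB * aA)))"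
    by (rule arg_cong[of _ _ cl]) (simp add: nf)
  also have "\<dots> = cl (const (w * al * be) * p + const (w * be) * (const al * p)
      - (const (m * q) * (p * aA * aB) - const (m * r) * (const b1 * p * aA)))"
    by (intro cl_add cl_mult cl_diff refl pK pB)
  also have "\<dots> = cl (const d0 * p - (const (m * q) * (p * aA * aB) - const (m * r * b1) * (p * aA)))"
    by (rule arg_cong[of _ _ cl]) (simp add: nf d0)
  finally have pD: "cl (p * aD) = cl (const d0 * p
      - (const (m * q) * (p * aA * aB) - const (m * r * b1) * (p * aA)))" .
  have "cl (aD * p) = cl ((const w * (const (al * be) + const be * aK)
      - const m * (const q * aA * aB - const r * aB * aA)) * p)"
    by (intro cl_mult refl D)
  also have "\<dots> = cl (const (w * al * be) * p + const (w * be) * (aK * p)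
      - (const (m * q) * (aA * (aB * p)) - const (m * r) * (aB * aA * p)))"
    by (rule arg_cong[of _ _ cl]) (simp add: nf)
  also have "\<dots> = cl (const (w * al * be) * p + const (w * be) * (const al * p)
      - (const (m * q) * (aA * (const b1 * p)) - const (m * r) * (aB * aA * p)))"
    by (intro cl_add cl_mult cl_diff refl Kp Bp)
  also have "\<dots> = cl (const d0 * p - (const (m * q * b1) * (aA * p) - const (m * r) * (aB * aA * p)))"
    by (rule arg_cong[of _ _ cl]) (simp add: nf d0)
  finally have Dp: "cl (aD * p) = cl (const d0 * p
      - (const (m * q * b1) * (aA * p) - const (m * r) * (aB * aA * p)))" .
  have "cl (p * (aD * p)) = cl (p * (const d0 * p
      - (const (m * q * b1) * (aA * p) - const (m * r) * (aB * aA * p))))"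
    by (intro cl_mult refl Dp)
  also have "\<dots> = cl (const d0 * (p * p)
      - (const (m * q * b1) * (p * aA * p) - const (m * r) * (p * aB * aA * p)))"
    by (rule arg_cong[of _ _ cl]) (simp add: nf)
  also have "\<dots> = cl (const d0 * (p * p)
      - (const (m * q * b1) * (p * aA * p) - const (m * r) * (const b1 * p * aA * p)))"
    by (intro cl_add cl_mult cl_diff refl pB)
  also have "\<dots> = cl (const d0 * (p * p) - const (m * (q - r) * b1) * (p * aA * p))"
    by (rule arg_cong[of _ _ cl]) (simp add: nf)
  finally have pDp: "cl (p * (aD * p)) = cl (const d0 * (p * p) - p * aA * p)"
    by (simp add: mb const_simps)
  have BB: "cl (aB * aB) = cl (const (b1 + b3) * aB - const (b1 * b3))"
  proof -
    have "aB * aB - (const (b1 + b3) * aB - const (b1 * b3)) = (aB - const b1) * (aB - const b3)"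
      by (simp add: const_simps const_normalize algebra_simps)
    then show ?thesis using B_quad eq_iff_diff by metis
  qed
  have AA: "cl (aA * aA) = cl (const (a1 + a2) * aA - const (a1 * a2))"
  proof -
    have "aA * aA - (const (a1 + a2) * aA - const (a1 * a2)) = (aA - const a1) * (aA - const a2)"
      by (simp add: const_simps const_normalize algebra_simps)
    then show ?thesis using A_quad eq_iff_diff by metis
  qed
  have DD: "cl (aD * aD) = cl (const (a1 + a2) * aD - const (a1 * a2))"
  proof -
    have "aD * aD - (const (a1 + a2) * aD - const (a1 * a2)) = (aD - const a1) * (aD - const a2)"
      by (simp add: const_simps const_normalize algebra_simps)
    then show ?thesis using D_quad eq_iff_diff by metis
  qed
  have pAAp: "cl (p * (aA * aA) * p) = cl (const (a1 + a2) * (p * aA * p) - const (a1 * a2) * (p * p))"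
  proof -
    have "cl (p * (aA * aA) * p) = cl (p * (const (a1 + a2) * aA - const (a1 * a2)) * p)"
      by (intro cl_mult refl AA)
    also have "\<dots> = cl (const (a1 + a2) * (p * aA * p) - const (a1 * a2) * (p * p))"
      by (rule arg_cong[of _ _ cl]) (simp add: nf)
    finally show ?thesis .
  qed
  \<comment> \<open>The element \<open>p D D p\<close> is computed twice: here by expanding
    \<open>p D\<close> and \<open>D p\<close>, afterwards from the quadratic relation of
    \<open>D\<close>.\<close>
  have "cl (p * aD * (aD * p)) = cl ((const d0 * p
      - (const (m * q) * (p * aA * aB) - const (m * r * b1) * (p * aA))) *
      (const d0 * p - (const (m * q * b1) * (aA * p) - const (m * r) * (aB * aA * p))))"
    by (intro cl_mult pD Dp)
  also have "\<dots> = cl (const (d0 * d0) * (p * p)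
      - const (d0 * m * (q - r) * b1) * (p * aA * p)
      + const (d0 * m * r) * (p * aB * aA * p) - const (d0 * m * q) * (p * aA * (aB * p))
      + const (m\<^sup>2 * (q\<^sup>2 + r\<^sup>2) * b1) * (p * aA * aB * aA * p)
      - const (m\<^sup>2 * (q * r)) * (p * aA * (aB * aB) * aA * p)
      - const (m\<^sup>2 * (q * r) * b1\<^sup>2) * (p * (aA * aA) * p))"
    by (rule arg_cong[of _ _ cl]) (simp add: nf power2_eq_square)
  also have "\<dots> = cl (const (d0 * d0) * (p * p)
      - const (d0 * m * (q - r) * b1) * (p * aA * p)
      + const (d0 * m * r) * (const b1 * p * aA * p) - const (d0 * m * q) * (p * aA * (const b1 * p))
      + const (m\<^sup>2 * (q\<^sup>2 + r\<^sup>2) * b1) * (p * aA * aB * aA * p)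
      - const (m\<^sup>2 * (q * r)) * (p * aA * (const (b1 + b3) * aB - const (b1 * b3)) * aA * p)
      - const (m\<^sup>2 * (q * r) * b1\<^sup>2) * (p * (aA * aA) * p))"
    by (intro cl_add cl_mult cl_diff refl pB Bp BB)
  also have "\<dots> = cl (const (d0 * d0) * (p * p)
      - (const d0 + const d0) * const (m * (q - r) * b1) * (p * aA * p)
      + const (m\<^sup>2 * ((q\<^sup>2 + r\<^sup>2) * b1 - (q * r) * (b1 + b3))) * (p * aA * aB * aA * p)
      + const ((q * r) * (m\<^sup>2 * (b3 - b1) * b1)) * (p * (aA * aA) * p))"
    by (rule arg_cong[of _ _ cl]) (simp add: nf power2_eq_square)
  also have "\<dots> = cl (const (d0 * d0) * (p * p) - (const d0 + const d0) * (p * aA * p) + p * (aA * aA) * p)"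
    \<comment> \<open>\<open>bb\<close> removes \<open>p A B A p\<close>, \<open>mbb\<close> gives
      \<open>p A A p\<close> the coefficient 1, and \<open>mb\<close> leaves twice \<open>d0\<close>
      in the linear term.\<close>
    unfolding qr bb mb mbb by (simp add: const_simps)
  also have "\<dots> = cl (const (d0 * d0) * (p * p) - (const d0 + const d0) * (p * aA * p)
      + (const (a1 + a2) * (p * aA * p) - const (a1 * a2) * (p * p)))"
    by (intro cl_add cl_diff refl pAAp)
  finally have lhs: "cl (p * aD * (aD * p)) = cl (const (d0 * d0) * (p * p)
      - (const d0 + const d0) * (p * aA * p)
      + (const (a1 + a2) * (p * aA * p) - const (a1 * a2) * (p * p)))" .
  have "cl (p * aD * (aD * p)) = cl (p * (aD * aD) * p)"
    by (simp add: mult.assoc)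
  also have "\<dots> = cl (p * (const (a1 + a2) * aD - const (a1 * a2)) * p)"
    by (intro cl_mult refl DD)
  also have "\<dots> = cl (const (a1 + a2) * (p * (aD * p)) - const (a1 * a2) * (p * p))"
    by (rule arg_cong[of _ _ cl]) (simp add: nf)
  also have "\<dots> = cl (const (a1 + a2) * (const d0 * (p * p) - p * aA * p) - const (a1 * a2) * (p * p))"
    by (intro cl_mult cl_diff refl pDp)
  finally have "cl (const (d0 * d0) * (p * p) - (const d0 + const d0) * (p * aA * p)
      + (const (a1 + a2) * (p * aA * p) - const (a1 * a2) * (p * p))
      - (const (a1 + a2) * (const d0 * (p * p) - p * aA * p) - const (a1 * a2) * (p * p))) = cl 0"
    unfolding lhs using eq_iff_diff by blast
  \<comment> \<open>The difference of the two results has the factor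
    \<open>2 * (a1 + a2 - d0)\<close>, which \<open>centre\<close> allows to be cancelled.\<close>
  also have "const (d0 * d0) * (p * p) - (const d0 + const d0) * (p * aA * p)
      + (const (a1 + a2) * (p * aA * p) - const (a1 * a2) * (p * p))
      - (const (a1 + a2) * (const d0 * (p * p) - p * aA * p) - const (a1 * a2) * (p * p))
      = (const (a1 + a2 - d0) + const (a1 + a2 - d0)) * (p * aA * p - const (w * al * be) * (p * p))"
    by (simp add: nf d0)
  also have "const (a1 + a2 - d0) + const (a1 + a2 - d0) = const ((a1 + a2 - d0) + (a1 + a2 - d0))"
    by (simp only: const_simps)
  finally have "cl (const ((a1 + a2 - d0) + (a1 + a2 - d0)) * (p * aA * p - const (w * al * be) * (p * p)))
      = cl (const ((a1 + a2 - d0) + (a1 + a2 - d0)) * 0)" by simp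
  then have "cl (p * aA * p - const (w * al * be) * (p * p)) = cl 0"
    by (rule scale_cancel) (use centre' in \<open>metis mult_2 mult_eq_0_iff zero_neq_numeral\<close>)
  then show ?thesis by (simp only: eq_iff_diff[symmetric])
qed

end

text \<open>Solves \<open>A = a - g * sigma0\<close> and \<open>B = b - h * sigma1\<close>. Clearing
  the tildes in the asserted formulas gives \<open>a = a2\<close>, \<open>b = b3\<close>,
  \<open>h = (q - r)^2\<close> and \<open>g = h * [2j]_q\<close>.\<close>

fun aw_image :: "complex \<Rightarrow> complex \<Rightarrow> complex \<Rightarrow> complex \<Rightarrow> tl_gen \<Rightarrow> aw_gen falg" where
  "aw_image a g b h Sigma0 = const (1 / g) * (const a - aA)"
| "aw_image a g b h Sigma1 = const (1 / h) * (const b - aB)"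

lemmas lift_falg = lift_hom_simps[OF central_hom_const]

context aw_cong
begin

context
  fixes g h :: complex
  assumes g: "g \<noteq> 0" and h: "h \<noteq> 0"
begin

abbreviation "im \<equiv> aw_image a2 g b3 h"

lemma im_sigma0_sq: "cl (im Sigma0 * im Sigma0) = cl (const ((a2 - a1) / g) * im Sigma0)"
proof -
  have "im Sigma0 * im Sigma0 - const ((a2 - a1) / g) * im Sigma0
      = const (1 / g * (1 / g)) * ((aA - const a1) * (aA - const a2))"
    unfolding diff_divide_distrib
    by (simp add: const_diff const_simps const_normalize algebra_simps divide_inverse)
  then show ?thesis using lmult_zero[OF A_quad] eq_iff_diff by metis
qed

lemma im_sigma1_sq: "cl (im Sigma1 * im Sigma1) = cl (const ((b3 - b1) / h) * im Sigma1)"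
proof -
  have "im Sigma1 * im Sigma1 - const ((b3 - b1) / h) * im Sigma1
      = const (1 / h * (1 / h)) * ((aB - const b1) * (aB - const b3))"
    unfolding diff_divide_distrib
    by (simp add: const_diff const_simps const_normalize algebra_simps divide_inverse)
  then show ?thesis using lmult_zero[OF B_quad] eq_iff_diff by metis
qed

text \<open>\<open>corner\<close> turns \<open>p (a2 - A) p\<close> into a multiple of
  \<open>p * p\<close>, hence of \<open>p\<close>; the hypothesis says that the accumulated factor
  is the right one.\<close>

lemma im_sigma101:
  assumes gh: "(a2 - w * al * be) * (b3 - b1) = h * g"
  shows "cl (im Sigma1 * im Sigma0 * im Sigma1) = cl (im Sigma1)"
proof -
  define p where "p = const b3 - aB"
  have pp: "cl (p * p) = cl (const (b3 - b1) * p)"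
  proof -
    have "p * p - const (b3 - b1) * p = (aB - const b1) * (aB - const b3)"
      by (simp add: p_def const_diff const_normalize algebra_simps)
    then show ?thesis using B_quad eq_iff_diff by metis
  qed
  have product: "const y * p * (const x * (const a2 - aA)) * (const y * p)
      = const (y * y * x) * (const a2 * (p * p) - p * aA * p)" for x y
    by (simp add: const_simps const_normalize const_left_commute[of p] const_commute[of p]
        algebra_simps)
  have "cl (im Sigma1 * im Sigma0 * im Sigma1)
      = cl (const (1 / h * (1 / h) * (1 / g)) * (const a2 * (p * p) - p * aA * p))"
    unfolding product[symmetric] by (simp add: p_def)
  also have "\<dots> = cl (const (1 / h * (1 / h) * (1 / g)) *
      (const a2 * (p * p) - const (w * al * be) * (p * p)))"
    by (intro cl_mult[OF refl] cl_diff[OF refl]) (simp only: p_def corner)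
  also have "\<dots> = cl (const (1 / h * (1 / h) * (1 / g) * (a2 - w * al * be)) * (p * p))"
    by (simp only: const_simps const_diff mult.assoc left_diff_distrib)
  also have "\<dots> = cl (const (1 / h * (1 / h) * (1 / g) * (a2 - w * al * be)) * (const (b3 - b1) * p))"
    by (intro cl_mult refl pp)
  also have "\<dots> = cl (const (1 / h * (1 / h) * (1 / g) * (a2 - w * al * be) * (b3 - b1)) * p)"
    by (simp only: const_simps mult.assoc)
  also have "1 / h * (1 / h) * (1 / g) * (a2 - w * al * be) * (b3 - b1) = 1 / h"
    using g h gh by (simp add: mult.assoc divide_simps)
  finally show ?thesis by (simp add: p_def)
qed

definition covered :: "aw_gen falg \<Rightarrow> bool"
  where "covered x \<longleftrightarrow> (\<exists>y. cl x = cl (lift const im y))"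

lemma coveredI: "cl x = cl (lift const im y) \<Longrightarrow> covered x"
  unfolding covered_def by blast

lemma covered_cong: "cl x = cl y \<Longrightarrow> covered y \<Longrightarrow> covered x"
  unfolding covered_def by metis

lemma covered_const: "covered (const c)"
  by (rule coveredI[of _ "const c"]) (simp add: lift_falg)

lemma covered_add: "covered x \<Longrightarrow> covered y \<Longrightarrow> covered (x + y)"
  unfolding covered_def by (elim exE, drule (1) cl_add, unfold lift_falg(1)[symmetric], erule exI)

lemma covered_diff: "covered x \<Longrightarrow> covered y \<Longrightarrow> covered (x - y)"
  unfolding covered_def by (elim exE, drule (1) cl_diff, unfold lift_falg(2)[symmetric], erule exI)

lemma covered_mult: "covered x \<Longrightarrow> covered y \<Longrightarrow> covered (x * y)"
  unfolding covered_def by (elim exE, drule (1) cl_mult, unfold lift_falg(3)[symmetric], erule exI)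

lemmas covered_intros = covered_add covered_diff covered_mult covered_const

lemma covered_A: "covered aA"
proof (rule coveredI)
  have "const g * im Sigma0 = const a2 - aA"
    using g by (simp add: mult.assoc[symmetric] const_simps(4)[symmetric] const_simps(2))
  then have "lift const im (const a2 - const g * sigma0) = aA"
    by (simp add: lift_falg del: aw_image.simps)
  then show "cl aA = cl (lift const im (const a2 - const g * sigma0))" by simp
qed

lemma covered_B: "covered aB"
proof (rule coveredI)
  have "const h * im Sigma1 = const b3 - aB"
    using h by (simp add: mult.assoc[symmetric] const_simps(4)[symmetric] const_simps(2))
  then have "lift const im (const b3 - const h * sigma1) = aB"
    by (simp add: lift_falg del: aw_image.simps)
  then show "cl aB = cl (lift const im (const b3 - const h * sigma1))" by simp
qed

text \<open>Eliminating \<open>D\<close> from the second relation leaves \<open>K (u - v A)\<close> as a polynomial in \<open>A\<close> and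
  \<open>B\<close>, and \<open>u - v A\<close> is invertible since neither eigenvalue of \<open>A\<close> is a root.\<close>

lemma covered_K:
  assumes "w * al \<noteq> w\<^sup>2 * be * a1" "w * al \<noteq> w\<^sup>2 * be * a2"
  shows "covered aK"
proof -
  \<comment> \<open>\<open>F\<close> is the part of \<open>D\<close> free of \<open>K\<close>;
    \<open>G\<close> collects what the second relation contains besides terms with
    \<open>K\<close>.\<close>
  define F where "F = const m * (const q * aA * aB - const r * aB * aA)"
  define G where "G = aB + const m * (const (w * al * be * (q - r)) * aA
    - (const q * F * aA - const r * aA * F)) - const (w * be * be)"
  have D: "cl aD = cl (const w * (const (al * be) + const be * aK) - F)"
    using cl_diff[OF rel3 refl, of F] by (simp add: F_def)
  have "cl (const w * (const (be * be) + const al * aK))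
      = cl (aB + const m * (const q * aD * aA - const r * aA * aD))"
    by (rule rel2[symmetric])
  also have "\<dots> = cl (aB + const m * (const q * (const w * (const (al * be) + const be * aK) - F) * aA
      - const r * aA * (const w * (const (al * be) + const be * aK) - F)))"
    by (intro cl_add cl_mult cl_diff refl D)
  also have "\<dots> = cl (aB + const m * (const (w * al * be * (q - r)) * aA
      - (const q * F * aA - const r * aA * F)
      + (const (w * be * q) * (aK * aA) - const (w * be * r) * (aA * aK))))"
    by (rule arg_cong[of _ _ cl]) (simp add: const_diff const_simps const_normalize algebra_simps)
  also have "\<dots> = cl (aB + const m * (const (w * al * be * (q - r)) * aA
      - (const q * F * aA - const r * aA * F)
      + (const (w * be * q) * (aK * aA) - const (w * be * r) * (aK * aA))))"
    by (intro cl_add cl_mult cl_diff refl K_commute[symmetric])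
  finally have "cl (const w * (const (be * be) + const al * aK)
        - (const (w * be * be) + const (w * be * (m * (q - r))) * (aK * aA)))
      = cl (aB + const m * (const (w * al * be * (q - r)) * aA
      - (const q * F * aA - const r * aA * F)
      + (const (w * be * q) * (aK * aA) - const (w * be * r) * (aK * aA)))
        - (const (w * be * be) + const (w * be * (m * (q - r))) * (aK * aA)))"
    by (intro cl_diff refl)
  also have "const w * (const (be * be) + const al * aK)
        - (const (w * be * be) + const (w * be * (m * (q - r))) * (aK * aA))
      = aK * (const (w * al) - const (w * be * (m * (q - r))) * aA)"
    by (simp add: const_diff const_simps const_normalize algebra_simps)
  also have "aB + const m * (const (w * al * be * (q - r)) * aA
      - (const q * F * aA - const r * aA * F)
      + (const (w * be * q) * (aK * aA) - const (w * be * r) * (aK * aA)))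
        - (const (w * be * be) + const (w * be * (m * (q - r))) * (aK * aA)) = G"
    by (simp add: G_def const_diff const_simps const_normalize algebra_simps)
  finally have KG: "cl (aK * (const (w * al) - const (w * be * (m * (q - r))) * aA)) = cl G" .
  define u v where "u = w * al" and "v = w * be * (m * (q - r))"
  define T where "T = const u - const v * aA"
  \<comment> \<open>The conjugate of \<open>T\<close>: replacing \<open>A\<close> by
    \<open>a1 + a2 - A\<close> exchanges the two eigenvalues, so \<open>T * T'\<close> is a scalar
    by the quadratic relation.\<close>
  define T' where "T' = const u - const v * (const (a1 + a2) - aA)"
  have "const ((u - v * a1) * (u - v * a2)) - T * T'
      = const (v * v) * ((aA - const a1) * (aA - const a2))"
    unfolding T_def T'_def
    by (simp add: const_diff const_simps const_normalize algebra_simps)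
  then have TT: "cl (T * T') = cl (const ((u - v * a1) * (u - v * a2)))"
    using lmult_zero[OF A_quad] eq_iff_diff by metis
  have "cl (const ((u - v * a1) * (u - v * a2)) * aK) = cl (aK * (T * T'))"
    unfolding const_commute[of aK, symmetric] by (intro cl_mult refl TT[symmetric])
  also have "\<dots> = cl (aK * T * T')" by (simp add: mult.assoc)
  also have "\<dots> = cl (G * T')"
    by (intro cl_mult refl) (simp add: T_def u_def v_def KG)
  finally have "cl (const (1 / ((u - v * a1) * (u - v * a2))) * (const ((u - v * a1) * (u - v * a2)) * aK))
      = cl (const (1 / ((u - v * a1) * (u - v * a2))) * (G * T'))"
    by (rule cl_mult[OF refl])
  moreover have "(u - v * a1) * (u - v * a2) \<noteq> 0"
    using assms by (simp add: u_def v_def mw power2_eq_square mult_ac)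
  then have "const (1 / ((u - v * a1) * (u - v * a2))) * (const ((u - v * a1) * (u - v * a2)) * aK) = aK"
    by (simp only: mult.assoc[symmetric] const_simps(4)[symmetric]) (simp add: const_simps(2))
  ultimately have K: "cl aK = cl (const (1 / ((u - v * a1) * (u - v * a2))) * (G * T'))"
    by simp
  have "covered F"
    unfolding F_def by (intro covered_intros covered_A covered_B)
  then have "covered (const (1 / ((u - v * a1) * (u - v * a2))) * (G * T'))"
    unfolding G_def T'_def by (intro covered_intros covered_A covered_B)
  with K show ?thesis by (rule covered_cong)
qed

lemma covered_all:
  assumes K: "w * al \<noteq> w\<^sup>2 * be * a1" "w * al \<noteq> w\<^sup>2 * be * a2"
    and alpha: "\<And>s. s \<in> {GAlpha1, GAlpha2, GAlpha3} \<Longrightarrow> \<exists>c. cl (gen s) = cl (const c)"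
  shows "covered x"
proof (induction x rule: falg_induct)
  case (gen s)
  have "cl aD = cl (const w * (const (al * be) + const be * aK)
      - const m * (const q * aA * aB - const r * aB * aA))"
    using cl_diff[OF rel3 refl, of "const m * (const q * aA * aB - const r * aB * aA)"] by simp
  then have "covered aD"
    by (rule covered_cong) (intro covered_intros covered_A covered_B covered_K[OF K])
  moreover have "covered (gen s)" if "s \<in> {GAlpha1, GAlpha2, GAlpha3}" for s
    using alpha[OF that] covered_cong covered_const by metis
  ultimately show ?case
    using covered_A covered_B covered_K[OF K] by (cases s) auto
qed (auto intro: covered_intros)

end

end

section \<open>Three representations of the quotient of the Askey--Wilson algebra\<close>

text \<open>\<open>z\<close> stands for q^(2j+1), with \<open>r\<close> and \<open>y\<close> the
  inverses of \<open>q\<close> and \<open>z\<close>. Treated as four letters with two cancellation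
  rules, they give every Laurent identity a normal form, without any inequality.\<close>

locale laurent =
  fixes q r z y :: complex
  assumes qr: "q * r = 1" and zy: "z * y = 1"
begin

lemma cancel:
  "r * q = 1" "y * z = 1" "q * (r * x) = x" "r * (q * x) = x" "z * (y * x) = x" "y * (z * x) = x"
  using qr zy by (metis mult.assoc mult.commute mult_1)+

lemmas laurent_normalize = algebra_simps power2_eq_square power3_eq_cube qr zy cancel

definition "al = z + y"
definition "be = q\<^sup>2 + r\<^sup>2"
definition "a1 = z * r + y * q"
definition "a2 = z * q + y * r"
definition "b1 = q + r"
definition "b3 = q ^ 3 + r ^ 3"
definition "k1 = z * r\<^sup>2 + y * q\<^sup>2"
definition "k3 = z * q\<^sup>2 + y * r\<^sup>2"
definition "h = (q - r)\<^sup>2"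
definition "g = (q - r) * (z * r - y * q)"

text \<open>\<open>matD\<close> and \<open>matD'\<close> are what the third relation and the definition of \<open>D'\<close> assign to \<open>D\<close>
  and \<open>D'\<close>; the denominator \<open>q + q\<^sup>-\<^sup>1\<close> cancels.\<close>

definition "matA = Mat2 a2 0 (- g) a1"
definition "matB = Mat2 b1 (- h) 0 b3"
definition "matD = Mat2 (z * (q - r + r ^ 3) + y * q) (z * h) (r\<^sup>2 * g) (z * (2 * r - r ^ 3) + y * r)"
definition "matD' = Mat2 (z * r + y * (q ^ 3 - q + r)) (y * h) (q\<^sup>2 * g) (z * q + y * (2 * q - q ^ 3))"

lemmas number_defs = al_def be_def a1_def a2_def b1_def b3_def k1_def k3_def h_def g_def
lemmas mat_defs = matA_def matB_def matD_def matD'_def scalar_mat2_def number_defs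

lemma matA_quad: "(matA - scalar_mat2 a1) * (matA - scalar_mat2 a2) = 0"
  by (simp add: matA_def scalar_mat2_def zero_mat2_def)

lemma matB_quad: "(matB - scalar_mat2 b1) * (matB - scalar_mat2 b3) = 0"
  by (simp add: matB_def scalar_mat2_def zero_mat2_def)

lemma matD_quad: "(matD - scalar_mat2 a1) * (matD - scalar_mat2 a2) = 0"
  unfolding mat_defs zero_mat2_def mat2_simps mat2.inject
  by (intro conjI; simp add: laurent_normalize)

lemma matD'_quad: "(matD' - scalar_mat2 a1) * (matD' - scalar_mat2 a2) = 0"
  unfolding mat_defs zero_mat2_def mat2_simps mat2.inject
  by (intro conjI; simp add: laurent_normalize)

text \<open>The relation at \<open>K = al\<close>, multiplied by
  \<open>q^2 - r^2 = (q - r) * (q + r)\<close> so that no denominator remains.\<close>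

lemma mat_rel1: "scalar_mat2 q * matB * matD - scalar_mat2 r * matD * matB
    = scalar_mat2 (q - r) * (scalar_mat2 (2 * al * be) - scalar_mat2 (q + r) * matA)"
  unfolding mat_defs zero_mat2_def mat2_simps mat2.inject
  by (intro conjI; simp add: laurent_normalize)

lemma mat_rel2: "scalar_mat2 q * matD * matA - scalar_mat2 r * matA * matD
    = scalar_mat2 (q - r) * (scalar_mat2 (be\<^sup>2 + al\<^sup>2) - scalar_mat2 (q + r) * matB)"
  unfolding mat_defs zero_mat2_def mat2_simps mat2.inject
  by (intro conjI; simp add: laurent_normalize)

lemma mat_rel3: "scalar_mat2 q * matA * matB - scalar_mat2 r * matB * matA
    = scalar_mat2 (q - r) * (scalar_mat2 (2 * al * be) - scalar_mat2 (q + r) * matD)"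
  unfolding mat_defs zero_mat2_def mat2_simps mat2.inject
  by (intro conjI; simp add: laurent_normalize)

lemma mat_rel3': "scalar_mat2 q * matB * matA - scalar_mat2 r * matA * matB
    = scalar_mat2 (q - r) * (scalar_mat2 (2 * al * be) - scalar_mat2 (q + r) * matD')"
  unfolding mat_defs zero_mat2_def mat2_simps mat2.inject
  by (intro conjI; simp add: laurent_normalize)

lemma mat_Omega:
  "scalar_mat2 (q * (2 * al * be)) * matA + scalar_mat2 (r * (be\<^sup>2 + al\<^sup>2)) * matB
    + scalar_mat2 (q * (2 * al * be)) * matD - scalar_mat2 (q\<^sup>2) * (matA * matA)
    - scalar_mat2 (r\<^sup>2) * (matB * matB) - scalar_mat2 (q\<^sup>2) * (matD * matD)
    - scalar_mat2 q * matA * matB * matD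
    = scalar_mat2 (2 * al\<^sup>2 + 2 * be\<^sup>2 + al\<^sup>2 * be\<^sup>2 - (q + r)\<^sup>2)"
  unfolding mat_defs zero_mat2_def mat2_simps mat2.inject
  by (intro conjI; simp add: laurent_normalize)

text \<open>The characters with \<open>B = b3\<close> and \<open>(A, D, K) = (a1, a1, k1)\<close> or \<open>(a2, a2, k3)\<close>.\<close>

lemma char_rels:
  assumes "(a, k) \<in> {(a1, k1), (a2, k3)}"
  shows "(q - r) * (b3 * a) = (q - r) * (al * be + be * k - (q + r) * a)"
    and "(q - r) * (a * a) = (q - r) * (be\<^sup>2 + al * k - (q + r) * b3)"
    and "q * a * (al * be + be * k) + r * b3 * (be\<^sup>2 + al * k) + q * a * (al * be + be * k)
      - q\<^sup>2 * a\<^sup>2 - r\<^sup>2 * b3\<^sup>2 - q\<^sup>2 * a\<^sup>2 - q * a * b3 * a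
      = al\<^sup>2 + 2 * be\<^sup>2 + k\<^sup>2 + al * be\<^sup>2 * k - (q + r)\<^sup>2"
proof -
  consider "a = a1" "k = k1" | "a = a2" "k = k3" using assms by auto
  note cases = this
  show "(q - r) * (b3 * a) = (q - r) * (al * be + be * k - (q + r) * a)"
    by (cases rule: cases; simp add: number_defs laurent_normalize)
  show "(q - r) * (a * a) = (q - r) * (be\<^sup>2 + al * k - (q + r) * b3)"
    by (cases rule: cases; simp add: number_defs laurent_normalize)
  show "q * a * (al * be + be * k) + r * b3 * (be\<^sup>2 + al * k) + q * a * (al * be + be * k)
      - q\<^sup>2 * a\<^sup>2 - r\<^sup>2 * b3\<^sup>2 - q\<^sup>2 * a\<^sup>2 - q * a * b3 * a
      = al\<^sup>2 + 2 * be\<^sup>2 + k\<^sup>2 + al * be\<^sup>2 * k - (q + r)\<^sup>2"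
    by (cases rule: cases; simp add: number_defs laurent_normalize)
qed

end

section \<open>Quantum numbers at a generic parameter\<close>

lemma J2_eq_image:
  assumes "\<bar>x - y\<bar> = lo" "x + y = lo + real n"
  shows "J2 x y = (\<lambda>k. lo + real k) ` {..n}"
  using assms by (auto simp: J2_def)

locale generic_parameter =
  fixes q :: complex and j :: real
  assumes q_nz: "q \<noteq> 0" and not_root: "\<forall>n::nat. n > 0 \<longrightarrow> q ^ n \<noteq> 1"
    and j_ge: "j \<ge> 1" and j_half: "2 * j \<in> \<nat>"
begin

definition "r = inverse q"
definition "z = q powr of_real (2 * j + 1)"
definition "y = inverse z"

sublocale laurent q r z y
  by unfold_locales (use q_nz in \<open>auto simp: r_def z_def y_def\<close>)

lemma powr_shift: "q powr of_real (x + real n) = q powr of_real x * q ^ n"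
  using q_nz by (simp add: powr_add powr_nat)

lemma powr_unshift: "q powr of_real (x - real n) = q powr of_real x * r ^ n"
proof -
  have "q powr of_real x = q powr of_real (x - real n) * q ^ n"
    using powr_shift[of "x - real n" n] by simp
  then show ?thesis using q_nz by (simp add: r_def power_inverse)
qed

lemma powr_real_nat: "q powr of_real (real n) = q ^ n"
  using powr_shift[of 0 n] q_nz by simp

lemma chi_eq:
  assumes "2 * s + 1 = e"
  shows "chi q s = q powr of_real e + inverse (q powr of_real e)"
proof -
  have "- 2 * s - 1 = - e" using assms by simp
  then show ?thesis unfolding chi_def assms by (simp add: powr_minus)
qed

lemma chi_shift:
  assumes "2 * s = 2 * j + real n"
  shows "chi q s = z * q ^ n + y * r ^ n"
  using chi_eq[of s "2 * j + 1 + real n"] assms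
  unfolding powr_shift z_def[symmetric] by (simp add: r_def y_def power_inverse)

lemma chi_unshift:
  assumes "2 * s = 2 * j - real n"
  shows "chi q s = z * r ^ n + y * q ^ n"
  using chi_eq[of s "2 * j + 1 - real n"] assms
  unfolding powr_unshift z_def[symmetric] by (simp add: r_def y_def power_inverse)

lemma chi_nat:
  assumes "2 * s + 1 = real n"
  shows "chi q s = q ^ n + r ^ n"
  using chi_eq[OF assms] unfolding powr_real_nat by (simp add: r_def power_inverse)

lemma chi_values:
  "chi q j = al" "chi q (1/2) = be" "chi q (j - 1/2) = a1" "chi q (j + 1/2) = a2"
  "chi q 0 = b1" "chi q 1 = b3" "chi q (j - 1) = k1" "chi q (j + 1) = k3"
  using chi_shift[of j 0] chi_nat[of "1/2" 2] chi_unshift[of "j - 1/2" 1] chi_shift[of "j + 1/2" 1]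
    chi_nat[of 0 1] chi_nat[of 1 3] chi_unshift[of "j - 1" 2] chi_shift[of "j + 1" 2]
  by (simp_all add: number_defs)

text \<open>The lower ends \<open>j - 1\<close> come from absolute values, which \<open>j_ge\<close>
  resolves.\<close>

lemma J2_values:
  "J2 j (1/2) = {j - 1/2, j + 1/2}" "J2 (1/2) (1/2) = {0, 1}"
  "J2 (j - 1/2) (1/2) = {j - 1, j}" "J2 (j + 1/2) (1/2) = {j, j + 1}"
  "J2 0 j = {j}" "J2 1 j = {j - 1, j, j + 1}"
  using j_ge J2_eq_image[of j "1/2" "j - 1/2" 1] J2_eq_image[of "1/2" "1/2" 0 1]
    J2_eq_image[of "j - 1/2" "1/2" "j - 1" 1] J2_eq_image[of "j + 1/2" "1/2" j 1]
    J2_eq_image[of 0 j j 0] J2_eq_image[of 1 j "j - 1" 2]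
  by (auto simp: atMost_Suc numeral_2_eq_2)

lemma J3_value: "J3 j (1/2) (1/2) = {j - 1, j, j + 1}"
  by (auto simp: J3_def J2_values)

text \<open>Missing from the first set are \<open>k1 - a2\<close> and \<open>k3 - a1\<close>: total
  spin j - 1 does not arise from j + 1/2, nor j + 1 from j - 1/2. That they coincide with none of
  the listed numbers is proved separately.\<close>

lemma M3_values:
  "M3 q j (1/2) (1/2) = {k1 - a1, al - a1, al - a2, k3 - a2}"
  "M3 q (1/2) (1/2) j = {al - b1, k1 - b3, al - b3, k3 - b3}"
proof -
  have M3: "M3 q x u v = (\<Union>i\<in>J2 x u. (\<lambda>l. chi q l - chi q i) ` J2 i v)" for x u v
    by (auto simp: M3_def)
  show "M3 q j (1/2) (1/2) = {k1 - a1, al - a1, al - a2, k3 - a2}"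
    "M3 q (1/2) (1/2) j = {al - b1, k1 - b3, al - b3, k3 - b3}"
    unfolding M3 J2_values by (simp_all add: J2_values chi_values insert_commute)
qed

lemma q_power_eq_iff: "q ^ a = q ^ b \<longleftrightarrow> a = b"
proof -
  have le: "a = b" if "a \<le> b" "q ^ a = q ^ b" for a b
  proof -
    have "q ^ b = q ^ a * q ^ (b - a)" using that(1) by (simp flip: power_add)
    with that(2) have "q ^ (b - a) = 1" using q_nz by simp
    then show ?thesis using not_root that(1) by (metis diff_is_0_eq le_antisym neq0_conv)
  qed
  show ?thesis using le[of a b] le[of b a] by (metis nat_le_linear)
qed

text \<open>The exponent is 2j + 1, a natural number because 2j is one.\<close>

lemma z_power:
  obtains N where "z = q ^ N" "N \<ge> 3"
proof -
  obtain n where n: "2 * j = real n" using j_half by (auto elim: Nats_cases)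
  have "z = q ^ (n + 1)"
    using powr_real_nat[of "n + 1"] by (simp add: z_def n add.commute)
  moreover have "n \<ge> 2" using n j_ge by linarith
  ultimately show ?thesis using that[of "n + 1"] by simp
qed

lemma q_neq_r: "q - r \<noteq> 0"
proof
  assume "q - r = 0"
  then have "q ^ 2 = q ^ 0" using qr by (simp add: power2_eq_square)
  then show False by (simp only: q_power_eq_iff)
qed

lemma q_plus_r: "q + r \<noteq> 0"
proof
  assume "q + r = 0"
  then have "r = - q" by (simp add: add_eq_0_iff)
  then have "q\<^sup>2 = - 1" using qr by (simp add: power2_eq_square) (metis minus_minus)
  then have "(q\<^sup>2)\<^sup>2 = 1" by simp
  then have "q ^ 4 = q ^ 0" by (simp flip: power_mult)
  then show False by (simp only: q_power_eq_iff)
qed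

lemma q_plus_one: "q + 1 \<noteq> 0"
proof
  assume "q + 1 = 0"
  then have "q ^ 2 = q ^ 0" by (simp add: add_eq_0_iff2 power2_eq_square)
  then show False by (simp only: q_power_eq_iff)
qed

text \<open>The exponent of \<open>z^2\<close> is at least 6, hence the bound 5.\<close>

lemma z_sq_neq_power: "z\<^sup>2 \<noteq> q ^ n" if "n \<le> 5"
proof -
  obtain N where N: "z = q ^ N" "N \<ge> 3" by (rule z_power)
  then have "z\<^sup>2 = q ^ (2 * N)" by (simp add: power_mult mult.commute)
  then show ?thesis using that N(2) by (simp add: q_power_eq_iff)
qed

lemma z_sq_mult_power_neq: "z\<^sup>2 * q ^ n \<noteq> 1"
proof
  obtain N where N: "z = q ^ N" "N \<ge> 3" by (rule z_power)
  assume "z\<^sup>2 * q ^ n = 1"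
  then have "q ^ (N * 2 + n) = q ^ 0" by (simp add: N(1) power_mult power_add)
  then show False using N(2) by (simp only: q_power_eq_iff)
qed

lemma z_sq_neq_minus_one: "z\<^sup>2 \<noteq> - 1"
proof
  obtain N where N: "z = q ^ N" "N \<ge> 3" by (rule z_power)
  assume "z\<^sup>2 = - 1"
  then have "(z\<^sup>2)\<^sup>2 = 1" by simp
  then have "q ^ (N * 2 * 2) = q ^ 0" by (simp add: N(1) flip: power_mult)
  then show False using N(2) by (simp only: q_power_eq_iff)
qed

text \<open>Multiplication by \<open>z\<close> and a power of \<open>q\<close> turns each expression
  into \<open>z^2 - q^n\<close>, \<open>z^2 * q^n - 1\<close> or \<open>z^2 + 1\<close>.\<close>

lemma z_neqs:
  "z - y \<noteq> 0" "z * r - y * q \<noteq> 0" "z * q - y * r \<noteq> 0" "z * r\<^sup>2 - y * q\<^sup>2 \<noteq> 0"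
  "z * q\<^sup>2 - y * r\<^sup>2 \<noteq> 0" "z * r - y \<noteq> 0" "z - y * r \<noteq> 0" "al \<noteq> 0"
proof -
  note nf = laurent_normalize
  show "z - y \<noteq> 0"
  proof
    assume "z - y = 0"
    then have "z * (z - y) = 0" by simp
    then show False using z_sq_neq_power[of 0] by (simp add: nf)
  qed
  show "z * r - y * q \<noteq> 0"
  proof
    assume "z * r - y * q = 0"
    then have "z * (q * (z * r - y * q)) = 0" by simp
    then show False using z_sq_neq_power[of 2] by (simp add: nf)
  qed
  show "z * q - y * r \<noteq> 0"
  proof
    assume "z * q - y * r = 0"
    then have "z * (q * (z * q - y * r)) = 0" by simp
    then show False using z_sq_mult_power_neq[of 2] by (simp add: nf)
  qed
  show "z * r\<^sup>2 - y * q\<^sup>2 \<noteq> 0"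
  proof
    assume "z * r\<^sup>2 - y * q\<^sup>2 = 0"
    then have "z * (q * (q * (z * r\<^sup>2 - y * q\<^sup>2))) = 0" by simp
    then show False using z_sq_neq_power[of 4] by (simp add: nf power4_eq_xxxx)
  qed
  show "z * q\<^sup>2 - y * r\<^sup>2 \<noteq> 0"
  proof
    assume "z * q\<^sup>2 - y * r\<^sup>2 = 0"
    then have "z * (q * (q * (z * q\<^sup>2 - y * r\<^sup>2))) = 0" by simp
    then show False using z_sq_mult_power_neq[of 4] by (simp add: nf power4_eq_xxxx)
  qed
  show "z * r - y \<noteq> 0"
  proof
    assume "z * r - y = 0"
    then have "z * (q * (z * r - y)) = 0" by simp
    then show False using z_sq_neq_power[of 1] by (simp add: nf)
  qed
  show "z - y * r \<noteq> 0"
  proof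
    assume "z - y * r = 0"
    then have "z * (q * (z - y * r)) = 0" by simp
    then show False using z_sq_mult_power_neq[of 1] by (simp add: nf)
  qed
  show "al \<noteq> 0"
  proof
    assume "al = 0"
    then have "z * al = 0" by simp
    then show False using z_sq_neq_minus_one by (simp add: al_def nf add_eq_0_iff)
  qed
qed

end

section \<open>The isomorphism\<close>

text \<open>The factors commute, so any one or two of them can be moved to the front. One factor
  suffices when the value is a scalar, two when it satisfies a quadratic equation.\<close>

lemma lift_aprod_eq_zero:
  fixes c :: "complex \<Rightarrow> 'b::ring_1"
  assumes c: "central_hom c" and S: "finite S"
    and X: "(\<exists>i\<in>S. lift c f x = c (e i)) \<or>
      (\<exists>i\<in>S. \<exists>k\<in>S. i \<noteq> k \<and> (lift c f x - c (e i)) * (lift c f x - c (e k)) = 0)"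
  shows "lift c f (aprod (\<lambda>i. x - const (e i)) S) = 0"
  using X
proof (elim disjE bexE conjE)
  fix i assume i: "i \<in> S" and X: "lift c f x = c (e i)"
  have "aprod (\<lambda>i. x - const (e i)) (insert i (S - {i}))
      = (x - const (e i)) * aprod (\<lambda>i. x - const (e i)) (S - {i})"
    by (rule aprod_linear_insert) (use S in auto)
  then show ?thesis
    using i X by (simp add: insert_absorb lift_hom_simps[OF c])
next
  fix i k assume i: "i \<in> S" and k: "k \<in> S" "i \<noteq> k"
    and X: "(lift c f x - c (e i)) * (lift c f x - c (e k)) = 0"
  have "aprod (\<lambda>i. x - const (e i)) (insert i (S - {i}))
      = (x - const (e i)) * aprod (\<lambda>i. x - const (e i)) (S - {i})"
    by (rule aprod_linear_insert) (use S in auto)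
  moreover have "aprod (\<lambda>i. x - const (e i)) (insert k (S - {i} - {k}))
      = (x - const (e k)) * aprod (\<lambda>i. x - const (e i)) (S - {i} - {k})"
    by (rule aprod_linear_insert) (use S in auto)
  moreover have "insert i (S - {i}) = S" "insert k (S - {i} - {k}) = S - {i}"
    using i k by auto
  ultimately show ?thesis
    using X by (simp add: lift_hom_simps[OF c] flip: mult.assoc)
qed

section \<open>Representations in which K is a scalar\<close>

context generic_parameter
begin

definition "w = 1 / (q + r)"
definition "m = 1 / (q\<^sup>2 - r\<^sup>2)"

lemma w_eq: "w * (q + r) = 1"
  using q_plus_r by (simp add: w_def)

lemma m_eq: "m * (q - r) = w"
proof -
  have "q\<^sup>2 - r\<^sup>2 = (q + r) * (q - r)" by (simp add: power2_eq_square algebra_simps)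
  then show ?thesis using q_neq_r by (simp add: m_def w_def)
qed

lemma qcomm_norm_eq: "qcomm_norm q X Y = const m * (const q * X * Y - const r * Y * X)"
  by (simp add: qcomm_norm_def qcomm_def m_def r_def)

lemma over_q2_eq: "over_q2 q X = const w * X"
  by (simp add: over_q2_def w_def r_def)

text \<open>Undoes the clearing of denominators, by \<open>m * (q - r) = w\<close> and
  \<open>w * (q + r) = 1\<close>.\<close>

lemma scaled_rel:
  assumes c: "central_hom c" and Y: "Y = c (q - r) * (c e - c (q + r) * X)"
  shows "c m * Y = c w * c e - X"
proof -
  note h = central_hom_simps[OF c, symmetric]
  have "c m * Y = c (m * (q - r)) * c e - c (m * (q - r) * (q + r)) * X"
    unfolding Y h(3)[symmetric] central_hom_simps(3)[OF c] by (simp add: right_diff_distrib mult.assoc)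
  then show ?thesis by (simp add: m_eq w_eq central_hom_simps[OF c])
qed

fun aw_rep :: "(complex \<Rightarrow> 'b) \<Rightarrow> 'b \<Rightarrow> 'b \<Rightarrow> 'b \<Rightarrow> complex \<Rightarrow> aw_gen \<Rightarrow> 'b" where
  "aw_rep c A B D k GA = A"
| "aw_rep c A B D k GB = B"
| "aw_rep c A B D k GD = D"
| "aw_rep c A B D k GK = c k"
| "aw_rep c A B D k GAlpha1 = c al"
| "aw_rep c A B D k GAlpha2 = c be"
| "aw_rep c A B D k GAlpha3 = c be"

end

text \<open>With equal second and third spin the right sides for \<open>A\<close>, \<open>D\<close>
  and \<open>D'\<close> share the numerator \<open>e1\<close>. As \<open>D'\<close> is no generator,
  its value is an extra parameter fixed by \<open>rel3'\<close>.\<close>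

locale aw_representation = generic_parameter +
  fixes c :: "complex \<Rightarrow> 'b::ring_1" and A B D D' :: 'b and k e1 e2 :: complex
  assumes c: "central_hom c"
    and e: "e1 = al * be + be * k" "e2 = be\<^sup>2 + al * k"
    and rel1: "c q * B * D - c r * D * B = c (q - r) * (c e1 - c (q + r) * A)"
    and rel2: "c q * D * A - c r * A * D = c (q - r) * (c e2 - c (q + r) * B)"
    and rel3: "c q * A * B - c r * B * A = c (q - r) * (c e1 - c (q + r) * D)"
    and rel3': "c q * B * A - c r * A * B = c (q - r) * (c e1 - c (q + r) * D')"
begin

lemmas aw_lift = lift_hom_simps[OF c]

lemma central_e: "c al * c be + c be * c k = c e1" "c be * c be + c al * c k = c e2"
  "c be * c al + c be * c k = c e1"
  using e by (simp_all add: central_hom_simps[OF c] power2_eq_square central_hom_commute[OF c, of "c be" al])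

lemma lift_AW3_rels:
  assumes "s \<in> AW3_rels q"
  shows "lift c (aw_rep c A B D k) s = 0"
proof -
  have scalar: "lift c (aw_rep c A B D k) (u * gen g - gen g * u) = 0"
    if "u \<in> {al1, al2, al3, aK}" for u g
    using that central_hom_commute[OF c] by (auto simp: aw_lift)
  show ?thesis
    using assms unfolding AW3_rels_def
  proof (elim UnE insertE emptyE)
    assume "s \<in> {u * gen g - gen g * u |u g. u \<in> {al1, al2, al3, aK}}"
    then show ?thesis using scalar by blast
  qed (simp_all add: qcomm_norm_eq over_q2_eq aw_lift central_e scaled_rel[OF c rel1]
      scaled_rel[OF c rel2] scaled_rel[OF c rel3])
qed

lemma lift_D': "lift c (aw_rep c A B D k) (aD' q) = D'"
  by (simp add: aD'_def qcomm_norm_eq over_q2_eq aw_lift central_e scaled_rel[OF c rel3'])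

lemma lift_AW_bar_rels:
  assumes Omega: "c (q * e1) * A + c (r * e2) * B + c (q * e1) * D - c (q\<^sup>2) * (A * A)
      - c (r\<^sup>2) * (B * B) - c (q\<^sup>2) * (D * D) - c q * A * B * D
      = c (al\<^sup>2 + 2 * be\<^sup>2 + k\<^sup>2 + al * be\<^sup>2 * k - (q + r)\<^sup>2)"
    and aprods: "\<And>x S. (x, S) \<in> {(aA, J2 j (1/2)), (aB, J2 (1/2) (1/2)), (aK, J3 j (1/2) (1/2)),
        (aD, J2 j (1/2)), (aD' q, J2 j (1/2))} \<Longrightarrow>
        lift c (aw_rep c A B D k) (aprod (\<lambda>i. x - const (chi q i)) S) = 0"
    and aprods': "\<And>x S. (x, S) \<in> {(aK - aA, M3 q j (1/2) (1/2)), (aK - aB, M3 q (1/2) (1/2) j),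
        (aK - aD, M3 q j (1/2) (1/2)), (aK - aD' q, M3 q j (1/2) (1/2))} \<Longrightarrow>
        lift c (aw_rep c A B D k) (aprod (\<lambda>i. x - const i) S) = 0"
    and s: "s \<in> AW_bar_rels q j (1/2) (1/2)"
  shows "lift c (aw_rep c A B D k) s = 0"
proof -
  have shift: "c u * X * c v = c (u * v) * X" for u v X
    unfolding central_hom_simps(3)[OF c] mult.assoc central_hom_commute[OF c, of X] ..
  have Om: "lift c (aw_rep c A B D k) (Omega q) = c (al\<^sup>2 + 2 * be\<^sup>2 + k\<^sup>2 + al * be\<^sup>2 * k - (q + r)\<^sup>2)"
    unfolding Omega[symmetric]
    by (simp add: Omega_def aw_lift central_e shift r_def[symmetric] power2_eq_square)
  have last: "lift c (aw_rep c A B D k) (Omega q - (const ((chi q j)\<^sup>2 + (chi q (1/2))\<^sup>2 + (chi q (1/2))\<^sup>2)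
      + aK\<^sup>2 + const (chi q j * chi q (1/2) * chi q (1/2)) * aK - const ((q + inverse q)\<^sup>2))) = 0"
  proof -
    have "c (al\<^sup>2 + be\<^sup>2 + be\<^sup>2) + (c k)\<^sup>2 + c (al * be * be) * c k - c ((q + r)\<^sup>2)
        + c ((q + r)\<^sup>2) = c (al\<^sup>2 + 2 * be\<^sup>2 + k\<^sup>2 + al * be\<^sup>2 * k - (q + r)\<^sup>2) + c ((q + r)\<^sup>2)"
      unfolding central_hom_simps(2)[OF c, symmetric]
      by (simp add: power2_eq_square central_hom_simps[OF c, symmetric] algebra_simps)
    then show ?thesis
      unfolding lift_diff[OF c] Om by (simp add: aw_lift chi_values r_def[symmetric])
  qed
  show ?thesis
    using s unfolding AW_bar_rels_def
    by (elim insertE emptyE; hypsubst)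
      (rule aprods aprods' last; simp | simp add: aw_lift chi_values)+
qed

end

section \<open>Nondegeneracy of the numbers involved\<close>

context generic_parameter
begin

text \<open>The weight \<open>[2j+1]_q / [2j]_q\<close> in the square of
  \<open>sigma0\<close>.\<close>

definition "t = (z - y) / (z * r - y * q)"

lemma g_nz: "g \<noteq> 0" and h_nz: "h \<noteq> 0"
  using q_neq_r z_neqs by (simp_all add: g_def h_def)

lemma number_diffs:
  "a2 - a1 = (q - r) * (z - y)" "b3 - b1 = h * (q + r)"
  "k1 - k3 = - ((q - r) * (q + r) * (z - y))"
  "k1 - al = - ((q - r) * (z * r - y * q))" "k3 - al = (q - r) * (z * q - y * r)"
  by (simp_all add: number_defs laurent_normalize)

lemma t_eq: "t = (a2 - a1) / g"
  using q_neq_r by (simp add: t_def g_def number_diffs)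

lemma t_nz: "t \<noteq> 0"
  using z_neqs by (simp add: t_def)

text \<open>Since \<open>[2]_q [2j+1]_q = [2j]_q + [2j+2]_q\<close>, equality would force
  \<open>[2j+2]_q = 0\<close>.\<close>

lemma dt_neq: "(q + r) * t \<noteq> 1"
proof
  assume "(q + r) * t = 1"
  then have "(q + r) * (z - y) = z * r - y * q" using z_neqs by (simp add: t_def field_simps)
  then have "z * q - y * r = 0" by (simp add: algebra_simps)
  then show False using z_neqs by simp
qed

lemma a_neq: "a1 \<noteq> a2"
  using number_diffs(1) q_neq_r z_neqs by auto

lemma b_neq: "b1 \<noteq> b3"
  using number_diffs(2) q_plus_r h_nz by auto

lemma k_neq: "k1 \<noteq> k3"
  using number_diffs(3) q_plus_r q_neq_r z_neqs by auto

lemma k1_a2_notin: "k1 - a2 \<notin> M3 q j (1/2) (1/2)"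
proof -
  \<comment> \<open>Of the four members of the set only this one shares neither term with
    \<open>k1 - a2\<close>; the difference still factors.\<close>
  have "k1 - a2 - (al - a1) = - ((q - r) * ((q + 1) * (z * r - y)))"
    by (simp add: number_defs laurent_normalize)
  then have "k1 - a2 \<noteq> al - a1" using q_neq_r q_plus_one z_neqs by auto
  moreover have "k1 \<noteq> al" using number_diffs(4) q_neq_r z_neqs by auto
  ultimately show ?thesis using a_neq k_neq by (auto simp: M3_values)
qed

lemma k3_a1_notin: "k3 - a1 \<notin> M3 q j (1/2) (1/2)"
proof -
  have "k3 - a1 - (al - a2) = (q - r) * ((q + 1) * (z - y * r))"
    by (simp add: number_defs laurent_normalize)
  then have "k3 - a1 \<noteq> al - a2" using q_neq_r q_plus_one z_neqs by auto
  moreover have "k3 \<noteq> al" using number_diffs(5) q_neq_r z_neqs by auto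
  ultimately show ?thesis using a_neq k_neq by (auto simp: M3_values)
qed

lemma w_cancel: "w * u = w * v \<longleftrightarrow> u = v" "w * u = v \<longleftrightarrow> u = (q + r) * v"
  using w_eq q_plus_r by (auto simp: w_def field_simps)

text \<open>After clearing \<open>q + r\<close> the difference is \<open>- al * (q - r)^2\<close>,
  and \<open>al = 0\<close> would mean \<open>z^2 = - 1\<close>.\<close>

lemma centre_neq: "a1 + a2 \<noteq> 2 * w * al * be"
proof
  assume "a1 + a2 = 2 * w * al * be"
  then have "w * (2 * al * be) = a1 + a2" by (simp add: ac_simps)
  then have "2 * al * be = (q + r) * (a1 + a2)" by (simp only: w_cancel)
  moreover have "(q + r) * (a1 + a2) - 2 * al * be = - (al * (q - r)\<^sup>2)"
    by (simp add: number_defs laurent_normalize)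
  ultimately show False using z_neqs(8) q_neq_r by simp
qed

text \<open>After clearing denominators the differences are, up to sign, \<open>(q - r)^2\<close>
  times \<open>[2j-1]_q\<close> and \<open>[2j+3]_q\<close>; the first would vanish for j =
  1/2.\<close>

lemma K_cover_neq: "w * al \<noteq> w\<^sup>2 * be * a1" "w * al \<noteq> w\<^sup>2 * be * a2"
proof -
  have "w * al = w\<^sup>2 * be * a \<longleftrightarrow> (q + r) * al = be * a" for a
  proof -
    have "w\<^sup>2 * be * a = w * (w * (be * a))" by (simp add: power2_eq_square mult.assoc)
    then show ?thesis using w_cancel(1)[of al] w_cancel(2)[of "be * a" al] by metis
  qed
  moreover have "(q + r) * al - be * a1 = (q - r) * (z * r\<^sup>2 - y * q\<^sup>2)"
    "(q + r) * al - be * a2 = - ((q - r) * (z * q\<^sup>2 - y * r\<^sup>2))"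
    by (simp_all add: number_defs laurent_normalize)
  ultimately show "w * al \<noteq> w\<^sup>2 * be * a1" "w * al \<noteq> w\<^sup>2 * be * a2"
    using q_neq_r z_neqs by auto
qed

lemma gh_eq: "(a2 - w * al * be) * (b3 - b1) = h * g"
proof -
  have "(a2 - w * al * be) * (q + r) = a2 * (q + r) - w * (q + r) * (al * be)"
    by (simp add: algebra_simps)
  also have "\<dots> = g" unfolding w_eq by (simp add: number_defs laurent_normalize)
  finally show ?thesis by (simp add: number_diffs mult.assoc mult.left_commute)
qed

text \<open>The second relation at the character with \<open>A = D = a\<close> and
  \<open>K = k\<close>, solved for \<open>B\<close>.\<close>

lemma edge_numbers:
  assumes "(a, k) \<in> {(a1, k1), (a2, k3)}"
  shows "b3 = w * (be * be + al * k) - m * (q - r) * a\<^sup>2"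
proof -
  have "a * a = be\<^sup>2 + al * k - (q + r) * b3"
    using char_rels(2)[OF assms] q_neq_r by simp
  then have "be * be + al * k - a\<^sup>2 = (q + r) * b3"
    by (simp add: power2_eq_square algebra_simps)
  then have "w * (be * be + al * k) - w * a\<^sup>2 = w * (q + r) * b3"
    by (simp only: right_diff_distrib[symmetric] mult.assoc)
  then show ?thesis by (simp add: m_eq w_eq)
qed

lemma qnum_values:
  "qnum q (of_real (2 * j + 1)) = (z - y) / (q - r)"
  "qnum q (of_real (2 * j)) = (z * r - y * q) / (q - r)"
  "qnum q 2 = q + r"
  "chi_tilde q (j + 1/2) = (a2 - b1) / h"
proof -
  have neg: "q powr - of_real x = inverse (q powr of_real x)" for x
    by (simp add: powr_minus)
  show "qnum q (of_real (2 * j + 1)) = (z - y) / (q - r)"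
    unfolding qnum_def neg y_def z_def r_def ..
  have "q powr of_real (2 * j) = z * r"
    using powr_unshift[of "2 * j + 1" 1] by (simp add: z_def)
  then show "qnum q (of_real (2 * j)) = (z * r - y * q) / (q - r)"
    unfolding qnum_def neg by (simp add: y_def r_def)
  have "q powr 2 = q\<^sup>2" "q powr - 2 = r\<^sup>2"
    using powr_real_nat[of 2] neg[of 2] by (simp_all add: r_def power_inverse)
  then have "qnum q 2 = (q\<^sup>2 - r\<^sup>2) / (q - r)" by (simp add: qnum_def r_def)
  also have "\<dots> = q + r" using q_neq_r by (simp add: power2_eq_square field_simps)
  finally show "qnum q 2 = q + r" .
  \<comment> \<open>The product \<open>[j+1/2]_q [j+3/2]_q\<close> involves \<open>s\<close> only
    through \<open>s * s\<close>, its inverse and \<open>s * inverse s\<close>, so the half-integral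
    power disappears in favour of \<open>z\<close> and \<open>y\<close>.\<close>
  define s where "s = q powr of_real (j + 1/2)"
  have "s * s = q powr (of_real (j + 1/2) + of_real (j + 1/2))"
    unfolding s_def powr_add ..
  also have "of_real (j + 1/2) + of_real (j + 1/2) = (of_real (2 * j + 1) :: complex)"
    by (simp flip: of_real_add)
  finally have s: "s * s = z" by (simp add: z_def)
  then have s': "inverse s * inverse s = y" by (simp add: y_def flip: inverse_mult_distrib)
  have s1: "s * inverse s = 1" using q_nz by (simp add: s_def)
  have sq: "q powr of_real (j + 1/2 + 1) = s * q"
    using powr_shift[of "j + 1/2" 1] by (simp add: s_def)
  have "chi_tilde q (j + 1/2) = ((s - inverse s) / (q - r)) * ((s * q - inverse s * r) / (q - r))"
    unfolding chi_tilde_def qnum_def neg sq s_def[symmetric] r_def by simp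
  also have "\<dots> = ((s * s) * q + (inverse s * inverse s) * r - (s * inverse s) * (q + r)) / (q - r)\<^sup>2"
    by (simp add: power2_eq_square algebra_simps)
  finally show "chi_tilde q (j + 1/2) = (a2 - b1) / h"
    unfolding s s' s1 by (simp add: a2_def b1_def h_def)
qed

lemma onebTL2_rels_eq: "onebTL2_rels q (of_real (2 * j + 1)) =
  {sigma0\<^sup>2 - const t * sigma0, sigma1\<^sup>2 - const (q + r) * sigma1, sigma1 * sigma0 * sigma1 - sigma1}"
proof -
  have "(of_real (2 * j + 1) - 1 :: complex) = of_real (2 * j)" by simp
  then have "qnum q (of_real (2 * j + 1)) / qnum q (of_real (2 * j + 1) - 1) = t"
    using q_neq_r by (simp only: qnum_values) (simp add: t_def)
  then show ?thesis by (simp only: onebTL2_rels_def r_def)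
qed

section \<open>Comparison of the two class maps\<close>

abbreviation "awcl \<equiv> AW_bar_class q j (1/2) (1/2)"
abbreviation "tlcl \<equiv> onebTL2_class q (of_real (2 * j + 1))"
abbreviation "img \<equiv> aw_image a2 g b3 h"

lemma falg_cong_awcl: "falg_cong awcl"
  by (rule falg_cong_alg_hom[OF AW_bar_class_alg_hom])

lemma falg_cong_tlcl: "falg_cong tlcl"
  by (rule falg_cong_alg_hom[OF onebTL2_class_alg_hom])

lemma M3_finite: "finite (M3 q j (1/2) (1/2))" "finite (M3 q (1/2) (1/2) j)"
  by (simp_all add: M3_values)

text \<open>Over the complex numbers a product vanishes with one factor, and the values of the
  elements, as well as \<open>k - a\<close> and \<open>k - b3\<close>, occur in the respective index
  sets.\<close>

lemma char_respects_awcl: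
  assumes ak: "(a, k) \<in> {(a1, k1), (a2, k3)}" and eq: "awcl x = awcl x'"
  shows "lift (\<lambda>c. c) (aw_rep (\<lambda>c. c) a b3 a k) x = lift (\<lambda>c. c) (aw_rep (\<lambda>c. c) a b3 a k) x'"
proof -
  note rels = char_rels[OF ak]
  interpret rep: aw_representation q j "\<lambda>c. c" a b3 a a k "al * be + be * k" "be\<^sup>2 + al * k"
    by unfold_locales (use rels(1,2) in \<open>simp_all add: central_hom_id algebra_simps\<close>)
  have *: "lift (\<lambda>c. c) (aw_rep (\<lambda>c. c) a b3 a k) s = 0" if "s \<in> AW_bar_rels q j (1/2) (1/2)" for s
  proof (rule rep.lift_AW_bar_rels[OF _ _ _ that])
    show "q * (al * be + be * k) * a + r * (be\<^sup>2 + al * k) * b3 + q * (al * be + be * k) * a - q\<^sup>2 * (a * a)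
      - r\<^sup>2 * (b3 * b3) - q\<^sup>2 * (a * a) - q * a * b3 * a
      = al\<^sup>2 + 2 * be\<^sup>2 + k\<^sup>2 + al * be\<^sup>2 * k - (q + r)\<^sup>2"
      unfolding rels(3)[symmetric] by (simp add: power2_eq_square algebra_simps)
  next
    fix x S
    assume "(x, S) \<in> {(aA, J2 j (1/2)), (aB, J2 (1/2) (1/2)), (aK, J3 j (1/2) (1/2)),
        (aD, J2 j (1/2)), (aD' q, J2 j (1/2))}"
    then show "lift (\<lambda>c. c) (aw_rep (\<lambda>c. c) a b3 a k) (aprod (\<lambda>i. x - const (chi q i)) S) = 0"
      using ak rep.lift_D'
      by (intro lift_aprod_eq_zero[OF central_hom_id])
        (auto simp: J2_values J3_value chi_values lift_complex)
  next
    fix x S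
    assume "(x, S) \<in> {(aK - aA, M3 q j (1/2) (1/2)), (aK - aB, M3 q (1/2) (1/2) j),
        (aK - aD, M3 q j (1/2) (1/2)), (aK - aD' q, M3 q j (1/2) (1/2))}"
    moreover have "k - a \<in> M3 q j (1/2) (1/2)" "k - b3 \<in> M3 q (1/2) (1/2) j"
      using ak by (auto simp: M3_values)
    ultimately have "lift (\<lambda>c. c) (aw_rep (\<lambda>c. c) a b3 a k) x \<in> S" "finite S"
      using rep.lift_D' M3_finite by (auto simp: lift_complex)
    then show "lift (\<lambda>c. c) (aw_rep (\<lambda>c. c) a b3 a k) (aprod (\<lambda>i. x - const i) S) = 0"
      by (intro lift_aprod_eq_zero[OF central_hom_id]) blast+
  qed
  show ?thesis
    using eq
    by (rule AW_bar_class_eq_imp_eq[OF falg_cong_lift[OF central_hom_id], rotated 2])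
      (simp_all add: * rep.lift_AW3_rels lift_complex)
qed

lemma mat_respects_awcl:
  assumes eq: "awcl x = awcl x'"
  shows "lift scalar_mat2 (aw_rep scalar_mat2 matA matB matD al) x
    = lift scalar_mat2 (aw_rep scalar_mat2 matA matB matD al) x'"
proof -
  interpret rep: aw_representation q j scalar_mat2 matA matB matD matD' al "2 * al * be" "be\<^sup>2 + al\<^sup>2"
    by unfold_locales
      (simp_all add: central_hom_scalar_mat2 mat_rel1 mat_rel2 mat_rel3 mat_rel3' power2_eq_square
        mult.commute)
  let ?L = "lift scalar_mat2 (aw_rep scalar_mat2 matA matB matD al)"
  \<comment> \<open>With \<open>K\<close> a scalar \<open>u\<close>, a quadratic relation for
    \<open>X\<close> with roots \<open>v\<close>, \<open>v'\<close> becomes one for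
    \<open>u - X\<close> with roots \<open>u - v\<close>, \<open>u - v'\<close>; this settles the
    products over \<open>M3\<close>.\<close>
  have flip: "(scalar_mat2 u - X - scalar_mat2 (u - v)) * (scalar_mat2 u - X - scalar_mat2 (u - v'))
      = (X - scalar_mat2 v) * (X - scalar_mat2 v')" for u v v' X
  proof -
    have "scalar_mat2 u - X - scalar_mat2 (u - v) = - (X - scalar_mat2 v)" for v
      using central_hom_simps(2)[OF central_hom_scalar_mat2, of "u - v" v] by (simp add: algebra_simps)
    then show ?thesis by (simp only: minus_mult_minus)
  qed
  have *: "?L s = 0" if "s \<in> AW_bar_rels q j (1/2) (1/2)" for s
  proof (rule rep.lift_AW_bar_rels[OF _ _ _ that])
    show "scalar_mat2 (q * (2 * al * be)) * matA + scalar_mat2 (r * (be\<^sup>2 + al\<^sup>2)) * matB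
    + scalar_mat2 (q * (2 * al * be)) * matD - scalar_mat2 (q\<^sup>2) * (matA * matA)
    - scalar_mat2 (r\<^sup>2) * (matB * matB) - scalar_mat2 (q\<^sup>2) * (matD * matD)
    - scalar_mat2 q * matA * matB * matD
    = scalar_mat2 (al\<^sup>2 + 2 * be\<^sup>2 + al\<^sup>2 + al * be\<^sup>2 * al - (q + r)\<^sup>2)"
      unfolding mat_Omega by (rule arg_cong[of _ _ scalar_mat2]) (simp add: power2_eq_square)
  next
    fix x S
    assume "(x, S) \<in> {(aA, J2 j (1/2)), (aB, J2 (1/2) (1/2)), (aK, J3 j (1/2) (1/2)),
        (aD, J2 j (1/2)), (aD' q, J2 j (1/2))}"
    then show "?L (aprod (\<lambda>i. x - const (chi q i)) S) = 0"
      using matA_quad matB_quad matD_quad matD'_quad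
      by (intro lift_aprod_eq_zero[OF central_hom_scalar_mat2])
        (auto simp: J2_values J3_value chi_values lift_mat2 rep.lift_D')
  next
    fix x S
    assume "(x, S) \<in> {(aK - aA, M3 q j (1/2) (1/2)), (aK - aB, M3 q (1/2) (1/2) j),
        (aK - aD, M3 q j (1/2) (1/2)), (aK - aD' q, M3 q j (1/2) (1/2))}"
    then consider "?L x \<in> {scalar_mat2 al - X |X. (X - scalar_mat2 a1) * (X - scalar_mat2 a2) = 0}"
        "S = M3 q j (1/2) (1/2)"
      | "?L x = scalar_mat2 al - matB" "S = M3 q (1/2) (1/2) j"
      using matA_quad matD_quad matD'_quad by (auto simp: lift_mat2 rep.lift_D')
    then show "?L (aprod (\<lambda>i. x - const i) S) = 0"
    proof cases
      case 1
      then obtain X where X: "?L x = scalar_mat2 al - X"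
        "(X - scalar_mat2 a1) * (X - scalar_mat2 a2) = 0" by blast
      have "al - a1 \<in> S" "al - a2 \<in> S" "al - a1 \<noteq> al - a2"
        using 1(2) a_neq by (auto simp: M3_values)
      moreover have "(?L x - scalar_mat2 (al - a1)) * (?L x - scalar_mat2 (al - a2)) = 0"
        using X by (simp only: flip)
      moreover have "finite S" using 1(2) M3_finite by simp
      ultimately show ?thesis
        by (intro lift_aprod_eq_zero[OF central_hom_scalar_mat2]) blast+
    next
      case 2
      have "al - b1 \<in> S" "al - b3 \<in> S" "al - b1 \<noteq> al - b3"
        using 2(2) b_neq by (auto simp: M3_values)
      moreover have "(?L x - scalar_mat2 (al - b1)) * (?L x - scalar_mat2 (al - b3)) = 0"
        using 2(1) matB_quad by (simp only: flip)
      moreover have "finite S" using 2(2) M3_finite by simp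
      ultimately show ?thesis
        by (intro lift_aprod_eq_zero[OF central_hom_scalar_mat2]) blast+
    qed
  qed
  show ?thesis
    using eq
    by (rule AW_bar_class_eq_imp_eq[OF falg_cong_lift[OF central_hom_scalar_mat2], rotated 2])
      (simp_all add: * rep.lift_AW3_rels lift_mat2)
qed

text \<open>\<open>sigma0\<close> becomes \<open>(a2 - A) / g\<close>, which is 0 at
  \<open>A = a2\<close> and \<open>t\<close> at \<open>A = a1\<close>; \<open>B = b3\<close> sends
  \<open>sigma1\<close> to 0.\<close>

lemma lift_image_char:
  assumes "(a, k, s) \<in> {(a1, k1, t), (a2, k3, 0)}"
  shows "lift (\<lambda>c. c) (aw_rep (\<lambda>c. c) a b3 a k) (lift const img x) = lift (\<lambda>c. c) (tl_char s) x"
proof (induction x rule: falg_induct)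
  case (gen s')
  show ?case using assms t_eq by (cases s') (auto simp: lift_falg lift_complex)
qed (simp_all add: lift_falg lift_complex)

text \<open>Explains \<open>matA\<close> and \<open>matB\<close>: they are
  \<open>a2 - g * sigma0\<close> and \<open>b3 - h * sigma1\<close> in the representation
  \<open>tl_mat\<close>, with diagonals simplified by \<open>g * t = a2 - a1\<close> and
  \<open>h * (q + r) = b3 - b1\<close>.\<close>

lemma lift_image_mat:
  "lift scalar_mat2 (aw_rep scalar_mat2 matA matB matD al) (lift const img x)
    = lift scalar_mat2 (tl_mat t (q + r)) x"
proof (induction x rule: falg_induct)
  case (gen s)
  have "b3 - b1 = h * (q + r)" by (rule number_diffs)
  then show ?case
    using g_nz h_nz t_eq
    by (cases s; simp only: lift_falg lift_mat2 aw_image.simps aw_rep.simps tl_mat.simps)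
      (simp_all add: scalar_mat2_def matA_def matB_def)
qed (simp_all add: lift_falg lift_mat2)

lemma awcl_rel: "s \<in> AW3_rels q \<union> AW_bar_rels q j (1/2) (1/2) \<Longrightarrow> awcl s = awcl 0"
  by (rule AW_bar_class_rel)

lemma awcl_alpha:
  "awcl al1 = awcl (const al)" "awcl al2 = awcl (const be)" "awcl al3 = awcl (const be)"
proof -
  interpret falg_cong awcl by (rule falg_cong_awcl)
  have "awcl (al1 - const al) = awcl 0" "awcl (al2 - const be) = awcl 0" "awcl (al3 - const be) = awcl 0"
    by (rule awcl_rel; simp add: AW_bar_rels_def chi_values)+
  then show "awcl al1 = awcl (const al)" "awcl al2 = awcl (const be)" "awcl al3 = awcl (const be)"
    by (simp_all only: eq_iff_diff[symmetric])
qed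

lemma aprod_pair: "u \<noteq> v \<Longrightarrow> aprod (\<lambda>i. x - const (e i)) {u, v} = (x - const (e u)) * (x - const (e v))"
  and aprod_triple: "u \<noteq> v \<Longrightarrow> u \<noteq> v' \<Longrightarrow> v \<noteq> v' \<Longrightarrow> aprod (\<lambda>i. x - const (e i)) {u, v, v'}
    = (x - const (e u)) * ((x - const (e v)) * (x - const (e v')))"
  by (simp_all add: aprod_linear_insert aprod_empty)

lemma aw_cong_awcl: "aw_cong awcl q r m w al be a1 a2 b1 b3 k1 k3 (M3 q j (1/2) (1/2))"
proof -
  interpret falg_cong awcl by (rule falg_cong_awcl)
  have in_bar: "awcl s = awcl 0" if "s \<in> AW_bar_rels q j (1/2) (1/2)" for s
    using that by (intro awcl_rel) blast
  have in_AW3: "awcl s = awcl 0" if "s \<in> AW3_rels q" for s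
    using that by (intro awcl_rel) blast
  show ?thesis
  proof unfold_locales
    have "awcl (aK * gen s - gen s * aK) = awcl 0" for s
      by (rule in_AW3) (auto simp: AW3_rels_def)
    then show "awcl (aK * gen s) = awcl (gen s * aK)" for s
      by (simp only: eq_iff_diff[symmetric])
  next
    have "awcl (aB + qcomm_norm q aD aA - over_q2 q (al2 * al3 + al1 * aK)) = awcl 0"
      by (rule in_AW3) (simp add: AW3_rels_def)
    then have "awcl (aB + const m * (const q * aD * aA - const r * aA * aD))
        = awcl (const w * (al2 * al3 + al1 * aK))"
      by (simp only: eq_iff_diff[symmetric] qcomm_norm_eq over_q2_eq)
    also have "\<dots> = awcl (const w * (const be * const be + const al * aK))"
      by (intro cl_add cl_mult refl awcl_alpha)
    finally show "awcl (aB + const m * (const q * aD * aA - const r * aA * aD))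
        = awcl (const w * (const (be * be) + const al * aK))"
      by (simp only: const_simps)
  next
    have "awcl (aD + qcomm_norm q aA aB - over_q2 q (al1 * al3 + al2 * aK)) = awcl 0"
      by (rule in_AW3) (simp add: AW3_rels_def)
    then have "awcl (aD + const m * (const q * aA * aB - const r * aB * aA))
        = awcl (const w * (al1 * al3 + al2 * aK))"
      by (simp only: eq_iff_diff[symmetric] qcomm_norm_eq over_q2_eq)
    also have "\<dots> = awcl (const w * (const al * const be + const be * aK))"
      by (intro cl_add cl_mult refl awcl_alpha)
    finally show "awcl (aD + const m * (const q * aA * aB - const r * aB * aA))
        = awcl (const w * (const (al * be) + const be * aK))"
      by (simp only: const_simps)
  next
    have *: "aprod (\<lambda>i. x - const (chi q i)) (J2 j (1/2)) = (x - const a1) * (x - const a2)" for x :: "aw_gen falg"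
      by (simp add: J2_values aprod_pair chi_values)
    have "awcl (aprod (\<lambda>i. aA - const (chi q i)) (J2 j (1/2))) = awcl 0"
      "awcl (aprod (\<lambda>i. aD - const (chi q i)) (J2 j (1/2))) = awcl 0"
      by (rule in_bar; simp add: AW_bar_rels_def)+
    then show "awcl ((aA - const a1) * (aA - const a2)) = awcl 0"
      "awcl ((aD - const a1) * (aD - const a2)) = awcl 0"
      by (simp_all only: *)
    have "awcl (aprod (\<lambda>i. aB - const (chi q i)) (J2 (1/2) (1/2))) = awcl 0"
      by (rule in_bar) (simp add: AW_bar_rels_def)
    then show "awcl ((aB - const b1) * (aB - const b3)) = awcl 0"
      by (simp add: J2_values aprod_pair chi_values)
    have "awcl (aprod (\<lambda>i. aK - const (chi q i)) (J3 j (1/2) (1/2))) = awcl 0"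
      by (rule in_bar) (simp add: AW_bar_rels_def)
    then show "awcl ((aK - const k1) * ((aK - const al) * (aK - const k3))) = awcl 0"
      by (simp add: J3_value aprod_triple chi_values)
    show "awcl (aprod (\<lambda>x. aK - aA - const x) (M3 q j (1/2) (1/2))) = awcl 0"
      "awcl (aprod (\<lambda>x. aK - aD - const x) (M3 q j (1/2) (1/2))) = awcl 0"
      by (rule in_bar; simp add: AW_bar_rels_def)+
    show "finite (M3 q j (1/2) (1/2))" by (rule M3_finite)
    show "k1 - a2 \<notin> M3 q j (1/2) (1/2)" by (rule k1_a2_notin)
    show "k3 - a1 \<notin> M3 q j (1/2) (1/2)" by (rule k3_a1_notin)
    show "b3 = w * (be * be + al * k1) - m * (q - r) * a1\<^sup>2"
      "b3 = w * (be * be + al * k3) - m * (q - r) * a2\<^sup>2"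
      by (rule edge_numbers; simp)+
    show "k1 \<noteq> k3" by (rule k_neq)
    show "q * r = 1" by (rule qr)
    show "m * (q - r) * b1 = 1" using w_eq by (simp add: m_eq b1_def)
    show "(q\<^sup>2 + r\<^sup>2) * b1 = b1 + b3" by (simp add: number_defs laurent_normalize)
    have "m\<^sup>2 * (b3 - b1) * b1 = (m * (q - r) * (q + r))\<^sup>2"
      by (simp only: number_diffs(2)) (simp add: h_def b1_def power2_eq_square)
    then show "m\<^sup>2 * (b3 - b1) * b1 = 1" by (simp add: m_eq w_eq)
    show "m * (q - r) = w" by (rule m_eq)
    show "a1 + a2 \<noteq> 2 * w * al * be" by (rule centre_neq)
  qed
qed

lemma awcl_image_rels:
  assumes "s \<in> onebTL2_rels q (of_real (2 * j + 1))"
  shows "awcl (lift const img s) = awcl (lift const img 0)"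
proof -
  interpret aw_cong awcl q r m w al be a1 a2 b1 b3 k1 k3 "M3 q j (1/2) (1/2)"
    by (rule aw_cong_awcl)
  have "awcl (img Sigma0 * img Sigma0 - const t * img Sigma0) = awcl 0"
    unfolding eq_iff_diff[symmetric] t_eq by (rule im_sigma0_sq[OF g_nz h_nz])
  moreover have "(b3 - b1) / h = q + r" using h_nz by (simp add: number_diffs)
  then have "awcl (img Sigma1 * img Sigma1 - const (q + r) * img Sigma1) = awcl 0"
    using im_sigma1_sq[OF g_nz h_nz] unfolding eq_iff_diff[symmetric] by (simp only:)
  moreover have "awcl (img Sigma1 * img Sigma0 * img Sigma1 - img Sigma1) = awcl 0"
    unfolding eq_iff_diff[symmetric] by (rule im_sigma101[OF g_nz h_nz gh_eq])
  ultimately show ?thesis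
    using assms unfolding onebTL2_rels_eq
    by (elim insertE emptyE) (simp_all only: lift_falg power2_eq_square)
qed

lemma tl_cong_tlcl: "tl_cong tlcl t (q + r)"
proof -
  interpret falg_cong tlcl by (rule falg_cong_tlcl)
  have "tlcl (sigma0\<^sup>2 - const t * sigma0) = tlcl 0"
    "tlcl (sigma1\<^sup>2 - const (q + r) * sigma1) = tlcl 0"
    "tlcl (sigma1 * sigma0 * sigma1 - sigma1) = tlcl 0"
    by (rule onebTL2_class_rel; unfold onebTL2_rels_eq; blast)+
  then show ?thesis
    unfolding eq_iff_diff[symmetric] power2_eq_square by unfold_locales
qed

lemma rep_respects_tlcl:
  assumes "tlcl x = tlcl x'"
  shows "a \<in> {0, t} \<Longrightarrow> lift (\<lambda>c. c) (tl_char a) x = lift (\<lambda>c. c) (tl_char a) x'"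
    and "lift scalar_mat2 (tl_mat t (q + r)) x = lift scalar_mat2 (tl_mat t (q + r)) x'"
proof -
  assume a: "a \<in> {0, t}"
  have "lift (\<lambda>c. c) (tl_char a) s = lift (\<lambda>c. c) (tl_char a) 0"
    if "s \<in> onebTL2_rels q (of_real (2 * j + 1))" for s
    using that a unfolding onebTL2_rels_eq
    by (elim insertE emptyE) (simp_all add: lift_complex power2_eq_square)
  from onebTL2_class_eq_imp_eq[OF falg_cong_lift[OF central_hom_id] this assms]
  show "lift (\<lambda>c. c) (tl_char a) x = lift (\<lambda>c. c) (tl_char a) x'" .
next
  have "lift scalar_mat2 (tl_mat t (q + r)) s = lift scalar_mat2 (tl_mat t (q + r)) 0"
    if "s \<in> onebTL2_rels q (of_real (2 * j + 1))" for s
    using that unfolding onebTL2_rels_eq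
    by (elim insertE emptyE)
      (simp_all add: lift_mat2 power2_eq_square, simp_all add: scalar_mat2_def zero_mat2_def)
  from onebTL2_class_eq_imp_eq[OF falg_cong_lift[OF central_hom_scalar_mat2] this assms]
  show "lift scalar_mat2 (tl_mat t (q + r)) x = lift scalar_mat2 (tl_mat t (q + r)) x'" .
qed

text \<open>Equal classes in 1bTL stay equal because its relations hold in \<open>AW_bar\<close>.
  Conversely, the three representations of \<open>AW_bar\<close> pull back to those of 1bTL, and
  these separate its elements.\<close>

lemma fibres: "awcl (lift const img x) = awcl (lift const img x') \<longleftrightarrow> tlcl x = tlcl x'"
proof
  have comp: "awcl \<circ> lift const img \<in> alg_hom free_alg (AW_bar q j (1/2) (1/2))"
    by (rule alg_hom_comp[OF lift_alg_hom AW_bar_class_alg_hom])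
  show "awcl (lift const img x) = awcl (lift const img x')" if "tlcl x = tlcl x'"
    using onebTL2_class_eq_imp_eq[OF falg_cong_alg_hom[OF comp] _ that] awcl_image_rels by simp
  assume eq: "awcl (lift const img x) = awcl (lift const img x')"
  interpret tl_cong tlcl t "q + r" by (rule tl_cong_tlcl)
  have "tlcl (x - x') = tlcl 0"
  proof (rule cl_zeroI[OF t_nz dt_neq])
    show "lift (\<lambda>c. c) (tl_char 0) (x - x') = 0"
      using char_respects_awcl[OF _ eq, of a2 k3]
      by (simp add: lift_image_char[of a2 k3 0] lift_complex)
    show "lift (\<lambda>c. c) (tl_char t) (x - x') = 0"
      using char_respects_awcl[OF _ eq, of a1 k1]
      by (simp add: lift_image_char[of a1 k1 t] lift_complex)
    show "lift scalar_mat2 (tl_mat t (q + r)) (x - x') = 0"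
      using mat_respects_awcl[OF eq] by (simp add: lift_image_mat lift_mat2)
  qed (rule rep_respects_tlcl; assumption)+
  then show "tlcl x = tlcl x'" by (simp only: eq_iff_diff[symmetric])
qed

lemma image_surj: "\<exists>y. awcl x = awcl (lift const img y)"
proof -
  interpret aw_cong awcl q r m w al be a1 a2 b1 b3 k1 k3 "M3 q j (1/2) (1/2)"
    by (rule aw_cong_awcl)
  have "covered g h x"
    by (rule covered_all[OF g_nz h_nz K_cover_neq]) (use awcl_alpha in auto)
  then show ?thesis by (simp add: covered_def[OF g_nz h_nz])
qed

lemma image_tilde:
  "lift const img (const (chi_tilde q (j + 1/2)) - const (qnum q (of_real (2 * j))) * sigma0) = tilde q aA"
  "lift const img (const (qnum q 2) - sigma1) = tilde q aB"
proof -
  have tilde: "tilde q X = const (1 / h) * (X - const b1)" for X :: "'a falg"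
    by (simp only: tilde_def h_def b1_def r_def[symmetric])
  have coeff: "(z * r - y * q) / (q - r) * (1 / g) = 1 / h"
    using q_neq_r z_neqs by (simp add: g_def h_def power2_eq_square)
  have "const ((a2 - b1) / h) - const ((z * r - y * q) / (q - r)) * (const (1 / g) * (const a2 - aA))
      = const ((1 / h) * (a2 - b1)) - const ((z * r - y * q) / (q - r) * (1 / g)) * (const a2 - aA)"
    by (simp only: const_simps mult.assoc) (simp add: const_simps(4)[symmetric])
  also have "\<dots> = const (1 / h) * (aA - const b1)"
    unfolding coeff const_simps const_diff by (simp add: algebra_simps)
  finally show "lift const img (const (chi_tilde q (j + 1/2)) - const (qnum q (of_real (2 * j))) * sigma0)
      = tilde q aA"
    by (simp only: lift_falg qnum_values tilde aw_image.simps)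
  have "const (q + r) - const (1 / h) * (const b3 - aB)
      = const (1 / h * (h * (q + r))) - const (1 / h) * (const b3 - aB)"
    using h_nz by simp
  also have "\<dots> = const (1 / h) * (aB - const b1)"
    unfolding number_diffs(2)[symmetric] const_simps const_diff by (simp add: algebra_simps)
  finally show "lift const img (const (qnum q 2) - sigma1) = tilde q aB"
    by (simp only: lift_falg qnum_values tilde aw_image.simps)
qed

text \<open>\<open>AW_bar\<close> is an image of the free algebra on \<open>sigma0\<close> and
  \<open>sigma1\<close>, and each of the two is an affine function of a tilde element.\<close>

lemma alg_hom_unique:
  assumes f: "f \<in> alg_hom (AW_bar q j (1/2) (1/2)) R" and f': "f' \<in> alg_hom (AW_bar q j (1/2) (1/2)) R"
    and A: "f (awcl (tilde q aA)) = f' (awcl (tilde q aA))"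
    and B: "f (awcl (tilde q aB)) = f' (awcl (tilde q aB))"
    and X: "X \<in> carrier (AW_bar q j (1/2) (1/2))"
  shows "f X = f' X"
proof -
  define p where "p = awcl \<circ> lift const img"
  have p: "p \<in> alg_hom free_alg (AW_bar q j (1/2) (1/2))"
    unfolding p_def by (rule alg_hom_comp[OF lift_alg_hom AW_bar_class_alg_hom])
  note hom = alg_hom_comp[OF p f] and hom' = alg_hom_comp[OF p f']
  note agree = alg_hom_agree[OF hom hom', unfolded comp_def]
  have linear: "f (p (gen s)) = f' (p (gen s))"
    if u: "f (p (const a - const b * gen s)) = f' (p (const a - const b * gen s))" and b: "b \<noteq> 0" for a b s
  proof -
    \<comment> \<open>Agreement is known to pass only to scalars, sums and products, so the
      difference is written with the scalar \<open>- 1\<close>.\<close>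
    have "gen s = const (1 / b) * (const a + const (- 1) * (const a - const b * gen s))"
    proof -
      have minus: "const (- 1) = (- 1 :: tl_gen falg)"
        using const_diff[of 0 1] by (simp add: const_simps)
      then have "const (1 / b) * (const a + const (- 1) * (const a - const b * gen s))
          = const (1 / b * b) * gen s"
        by (simp only: minus const_simps mult.assoc) simp
      then show ?thesis using b by (simp add: const_simps)
    qed
    then show ?thesis using agree u by metis
  qed
  have "f (p (gen s)) = f' (p (gen s))" for s
  proof (cases s)
    case Sigma0
    have "qnum q (of_real (2 * j)) \<noteq> 0"
      unfolding qnum_values using q_neq_r z_neqs by simp
    with A show ?thesis
      unfolding Sigma0 by (intro linear[of "chi_tilde q (j + 1/2)"]) (simp_all only: p_def comp_def image_tilde)
  next
    case Sigma1
    have "const (qnum q 2) - sigma1 = const (qnum q 2) - const 1 * sigma1" by (simp add: const_simps)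
    then have "p (const (qnum q 2) - const 1 * sigma1) = awcl (tilde q aB)"
      by (simp only: p_def comp_def flip: image_tilde)
    with B show ?thesis
      unfolding Sigma1 by (intro linear[of "qnum q 2" 1]) simp_all
  qed
  then have "(f \<circ> p) v = (f' \<circ> p) v" for v
    by - (rule alg_hom_eqI[OF hom hom'], simp)
  moreover obtain v where "X = p v"
    using X image_surj unfolding AW_bar_class_surj[symmetric] p_def by auto
  ultimately show ?thesis by simp
qed

end

theorem theorem9p2:
  fixes q :: complex and j :: real
  assumes "q \<noteq> 0" and "\<forall>n::nat. n > 0 \<longrightarrow> q ^ n \<noteq> 1"
    and "j \<ge> 1" and "2 * j \<in> \<nat>"
  shows "\<exists>\<phi> \<in> alg_iso (AW_bar q j (1/2) (1/2)) (onebTL2 q (of_real (2 * j + 1))).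
      \<phi> (AW_bar_class q j (1/2) (1/2) (tilde q aA))
        = onebTL2_class q (of_real (2 * j + 1)) (const (chi_tilde q (j + 1/2)) - const (qnum q (of_real (2 * j))) * sigma0)
    \<and> \<phi> (AW_bar_class q j (1/2) (1/2) (tilde q aB))
        = onebTL2_class q (of_real (2 * j + 1)) (const (qnum q 2) - sigma1)
    \<and> (\<forall>\<psi> \<in> alg_hom (AW_bar q j (1/2) (1/2)) (onebTL2 q (of_real (2 * j + 1))).
          \<psi> (AW_bar_class q j (1/2) (1/2) (tilde q aA)) = \<phi> (AW_bar_class q j (1/2) (1/2) (tilde q aA))
        \<longrightarrow> \<psi> (AW_bar_class q j (1/2) (1/2) (tilde q aB)) = \<phi> (AW_bar_class q j (1/2) (1/2) (tilde q aB))
        \<longrightarrow> (\<forall>x \<in> carrier (AW_bar q j (1/2) (1/2)). \<psi> x = \<phi> x))"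
proof -
  interpret generic_parameter q j by unfold_locales (use assms in auto)
  \<comment> \<open>\<open>?p\<close> and \<open>tlcl\<close> are surjections from the same free
    algebra; sending \<open>?p x\<close> to \<open>tlcl x\<close> gives the map in the asserted
    direction.\<close>
  let ?p = "awcl \<circ> lift const img"
  have "\<exists>\<phi>\<in>alg_iso (AW_bar q j (1/2) (1/2)) (onebTL2 q (of_real (2 * j + 1))).
      \<forall>x\<in>carrier free_alg. \<phi> (?p x) = tlcl x"
  proof (rule alg_iso_of_same_fibres)
    show "?p \<in> alg_hom free_alg (AW_bar q j (1/2) (1/2))"
      by (rule alg_hom_comp[OF lift_alg_hom AW_bar_class_alg_hom])
    show "?p ` carrier free_alg = carrier (AW_bar q j (1/2) (1/2))"
      using image_surj unfolding AW_bar_class_surj[symmetric] by (auto simp: image_iff)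
    show "tlcl \<in> alg_hom free_alg (onebTL2 q (of_real (2 * j + 1)))"
      by (rule onebTL2_class_alg_hom)
    show "tlcl ` carrier free_alg = carrier (onebTL2 q (of_real (2 * j + 1)))"
      using onebTL2_class_surj by simp
    show "ring free_alg" by (rule ring_free_alg)
    show "?p x = ?p y \<longleftrightarrow> tlcl x = tlcl y" for x y
      by (simp only: comp_def fibres)
  qed simp
  then obtain \<phi> where \<phi>: "\<phi> \<in> alg_iso (AW_bar q j (1/2) (1/2)) (onebTL2 q (of_real (2 * j + 1)))"
    and eq: "\<And>x. \<phi> (awcl (lift const img x)) = tlcl x" by auto
  have hom: "\<phi> \<in> alg_hom (AW_bar q j (1/2) (1/2)) (onebTL2 q (of_real (2 * j + 1)))"
    using \<phi> by (simp add: alg_iso_def)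
  show ?thesis
  proof (intro bexI[OF _ \<phi>] conjI ballI impI)
    show "\<phi> (awcl (tilde q aA))
        = tlcl (const (chi_tilde q (j + 1/2)) - const (qnum q (of_real (2 * j))) * sigma0)"
      by (simp only: eq flip: image_tilde)
    show "\<phi> (awcl (tilde q aB)) = tlcl (const (qnum q 2) - sigma1)"
      by (simp only: eq flip: image_tilde)
  qed (rule alg_hom_unique[OF _ hom])
qed

end
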